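(* Let $n,m\ge 1$, $Q\in\mathbb{R}^{n\times n}$ symmetric positive semidefinite, $c\in\mathbb{R}^n$, $A\in\mathbb{R}^{m\times n}$, $b\in\mathbb{R}^m$, $0<\mathrm{tol}<1$, with $A,Q,c$ not all zero and with the parameters of the context satisfying $\tau_E<\tau_A$. Let $\Omega=\{\xi\in\mathbb{R}^n:\|\xi\|_\infty<1\}$, $q(x)=\frac12 x^{\mathsf T}Qx+c^{\mathsf T}x$, $\chi=\min_{\xi\in\overline\Omega}\|A\xi-b\|_2$, and let $x^\star$ be a minimizer of $q$ over $\{x\in\overline\Omega:\|Ax-b\|_2=\chi\}$. Then the interior point algorithm described in the context, executed in exact arithmetic, returns a vector $x\in\mathbb{R}^n$ with $$x\in\Omega,\qquad q(x)\le q(x^\star)+\mathrm{tol},\qquad \|Ax-b\|_2\le\chi+\mathrm{tol}.$$ Moreover, with $$L=\log\big(1+\|Q\|_2+\|c\|_2+\|A\|_2+\|b\|_2\big)+\log(n+m)-\log(\mathrm{tol}),$$ the number of iterations and the number of linear systems (each of dimension at most $3n+m$) solved by the algorithm are both bounded by $C\cdot L\cdot\sqrt n$ with a universal constant $C>0$ independent of the problem instance.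
   Context: $\|\cdot\|_2$ is the Euclidean/spectral norm, $\|\cdot\|_F$ the Frobenius norm, $\mathbf 1$ the all-ones vector; products and quotients of vectors of the same length are componentwise. Parameters (computed in this order, except that $C_\nu$ precedes $\nu_2$): $\theta=0.3$, $\beta=\theta$, $\sigma=1-\beta/\sqrt{2n}$, $N=3n+m$, $C_{Hf}=10$, $C_q=\|Q\|_2n+\|c\|_2\sqrt n$, $\omega=\min\{\frac{\mathrm{tol}}{2n},\frac{\mathrm{tol}^2}{16(4C_q+n)},1\}$, $C_\lambda=(\|A\|_2\sqrt n+\|b\|_2)/\omega$, $C_{\Delta\mu}=(\omega+\|Q\|_2)\sqrt n+\|c\|_2+\|A\|_2C_\lambda$, $\tau_A=\max\{\frac14\|Q+\omega I+\frac1\omega A^{\mathsf T}A\|_2,\ 4\|c-\frac1\omega A^{\mathsf T}b\|_2\}$, $\tau_E=\frac{\mathrm{tol}^2\,\omega}{48n\max\{\|A\|_2,C_q\}^2}$, $C_\mu=\sqrt{2n}(C_{\Delta\mu}+(1+\theta)\tau_A)$, $C_z=\sqrt{n+C_\lambda^2+C_\mu^2}+0.1$, $c_{gap}=\frac{1-\theta}{1+C_z}\cdot\frac{\sigma\tau_E}{2}$, $C_{DF}=\|Q\|_2+2\omega+2\|A\|_F+4+4C_z$, $C_{DFinv}=\frac1{c_{gap}}\max\{\frac1\omega,\frac{C_z}{c_{gap}}\}$, $\kappa_{DF}=C_{DF}C_{DFinv}$, $C_{\delta F}=C_{DF}$, $C_{\delta DF}=2$, $C_{\delta\Delta z}=2\kappa_{DF}$,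 $C_\nu=\max\{2C_{\delta\Delta z}(C_{\delta F}C_{DFinv}+\frac2\omega C_{\delta DF}C_z),\,1+C_{DFinv}C_{\delta F}\}$, $\nu_2=\min\{0.1,\frac{c_{gap}}{C_\nu},\frac{\omega}{2C_{\delta DF}\kappa_{DF}},\frac{\theta\sigma\tau_E}{2C_\nu C_{\delta F}}\}$, $\rho=\frac1{4\sqrt N}\cdot\frac{\nu_2}{\|A\|_2/\omega+1+8\tau_A}$, $K=\lceil\log_2(1+\log_2(C_{Hf}/\rho))\rceil$, $M=\big\lceil\frac{\log\tau_E-\log\tau_A}{\log\sigma}\big\rceil$. Functions: $$f(x)=\frac1{\tau_A}\Big(q(x)+\frac\omega2\|x\|_2^2+\frac1{2\omega}\|Ax-b\|_2^2\Big)-\sum_{j=1}^n\big(\log(1+x^{[j]})+\log(1-x^{[j]})\big),$$ and for $z=(x,\lambda,\mu_L,\mu_R)\in\mathbb{R}^{n}\times\mathbb{R}^m\times\mathbb{R}^n\times\mathbb{R}^n$, $$F_\tau(z)=\begin{pmatrix}Qx+\omega x+c-A^{\mathsf T}\lambda-\mu_L+\mu_R\\ Ax-b+\omega\lambda\\ \mu_L\cdot(\mathbf 1+x)-\tau\mathbf 1\\ \mu_R\cdot(\mathbf 1-x)-\tau\mathbf 1\end{pmatrix},$$ with Jacobian $DF(z)$ (independent of $\tau$). Algorithm. (Initialization) $x_0=0$; for $k=1,\dots,K$: $x_k=x_{k-1}-\nabla^2f(x_{k-1})^{-1}\nabla f(x_{k-1})$. Set $\check z=(x_K,-\frac1\omega(Ax_K-b),\tau_A/(\mathbf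 1+x_K),\tau_A/(\mathbf 1-x_K))$, $(r^{(1)},r^{(2)},r^{(3)},r^{(4)})=F_{\tau_A}(\check z)$, $z=\check z-DF(\check z)^{-1}(r^{(1)},r^{(2)},0,0)$, $\tau=\tau_A$. (Path-following) For $k=1,\dots,M$: let $\hat\tau=\sigma\tau$; $z_1=z-DF(z)^{-1}F_{\hat\tau}(z)$; $z_2=z_1-DF(z_1)^{-1}F_{\hat\tau}(z_1)$; $(r^{(1)},r^{(2)},r^{(3)},r^{(4)})=F_{\hat\tau}(z_2)$; $z_3=z_2-DF(z_2)^{-1}(r^{(1)},r^{(2)},0,0)$; set $\tau=\hat\tau$, $z=z_3$; stop the loop if $\tau\le\tau_E$. (Termination) Return the component $x$ of $z$. *)

theory Defs
  imports
    "HOL-Analysis.Analysis"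
    "HOL-Library.Monad_Syntax"
    "Jordan_Normal_Form.Gauss_Jordan_Elimination"
begin

text \<open>
  The complexity constant has to be uniform in the dimensions, so vectors and matrices are those of
  \<^theory>\<open>Jordan_Normal_Form.Matrix\<close>, whose dimensions are ordinary natural numbers. The
  type-indexed vectors of \<^theory>\<open>HOL-Analysis.Finite_Cartesian_Product\<close> are hidden.
\<close>

unbundle no vec_syntax
unbundle no inner_syntax
hide_const (open) Finite_Cartesian_Product.vec Finite_Cartesian_Product.mat
  Finite_Cartesian_Product.row Finite_Cartesian_Product.column Finite_Cartesian_Product.transpose

definition norm2 :: "real vec \<Rightarrow> real" where
  "norm2 v = sqrt (\<Sum>i<dim_vec v. (v $ i)\<^sup>2)"

definition norm_max :: "real vec \<Rightarrow> real" where
  "norm_max v = Max ((\<lambda>i. \<bar>v $ i\<bar>) ` {..<dim_vec v})"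

definition spectral_norm :: "real mat \<Rightarrow> real" where
  "spectral_norm M = Sup {norm2 (M *\<^sub>v v) | v. v \<in> carrier_vec (dim_col M) \<and> norm2 v \<le> 1}"

definition frobenius_norm :: "real mat \<Rightarrow> real" where
  "frobenius_norm M = sqrt (\<Sum>i<dim_row M. \<Sum>j<dim_col M. (M $$ (i, j))\<^sup>2)"

definition ones_vec :: "nat \<Rightarrow> real vec" where
  "ones_vec k = vec k (\<lambda>_. 1)"

definition times_cw :: "real vec \<Rightarrow> real vec \<Rightarrow> real vec" where
  "times_cw u v = vec (dim_vec u) (\<lambda>i. u $ i * v $ i)"

text \<open>The scalar \<open>s\<close> divided componentwise by \<open>v\<close>; undefined if a component vanishes.\<close>

definition divide_cw :: "real \<Rightarrow> real vec \<Rightarrow> real vec option" where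
  "divide_cw s v = (if \<forall>i<dim_vec v. v $ i \<noteq> 0 then Some (vec (dim_vec v) (\<lambda>i. s / v $ i)) else None)"

definition vec_block :: "nat \<Rightarrow> nat \<Rightarrow> real vec \<Rightarrow> real vec" where
  "vec_block off len z = vec len (\<lambda>i. z $ (off + i))"

definition gradient :: "(real vec \<Rightarrow> real) \<Rightarrow> real vec \<Rightarrow> real vec" where
  "gradient g x =
     vec (dim_vec x) (\<lambda>i. deriv (\<lambda>t. g (x + t \<cdot>\<^sub>v unit_vec (dim_vec x) i)) 0)"

definition jacobian :: "(real vec \<Rightarrow> real vec) \<Rightarrow> real vec \<Rightarrow> real mat" where
  "jacobian G x =
     mat (dim_vec (G x)) (dim_vec x)
       (\<lambda>(i, j). deriv (\<lambda>t. G (x + t \<cdot>\<^sub>v unit_vec (dim_vec x) j) $ i) 0)"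

definition hessian :: "(real vec \<Rightarrow> real) \<Rightarrow> real vec \<Rightarrow> real mat" where
  "hessian g = jacobian (gradient g)"

text \<open>
  \<open>solve M r ds\<close> computes \<open>M\<inverse> r\<close> and fails if \<open>M\<close> is singular. The list \<open>ds\<close> records the
  dimensions of all linear systems solved so far.
\<close>

definition solve :: "real mat \<Rightarrow> real vec \<Rightarrow> nat list \<Rightarrow> (real vec \<times> nat list) option" where
  "solve M r ds = do {
     B \<leftarrow> mat_inverse M;
     Some (B *\<^sub>v r, dim_row M # ds)
   }"

definition Omega :: "nat \<Rightarrow> real vec set" where
  "Omega n = {x \<in> carrier_vec n. norm_max x < 1}"

definition Omega_closure :: "nat \<Rightarrow> real vec set" where
  "Omega_closure n = {x \<in> carrier_vec n. norm_max x \<le> 1}"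

definition quad_obj :: "real mat \<Rightarrow> real vec \<Rightarrow> real vec \<Rightarrow> real" where
  "quad_obj Q c x = 1 / 2 * (x \<bullet> (Q *\<^sub>v x)) + c \<bullet> x"

text \<open>The infimum is a minimum, since the closed box is compact and nonempty.\<close>

definition min_residual :: "nat \<Rightarrow> real mat \<Rightarrow> real vec \<Rightarrow> real" where
  "min_residual n A b = (INF \<xi>\<in>Omega_closure n. norm2 (A *\<^sub>v \<xi> - b))"

definition sym_psd :: "nat \<Rightarrow> real mat \<Rightarrow> bool" where
  "sym_psd n Q \<longleftrightarrow> Q \<in> carrier_mat n n \<and> transpose_mat Q = Q \<and>
     (\<forall>v\<in>carrier_vec n. 0 \<le> v \<bullet> (Q *\<^sub>v v))"

locale ipm =
  fixes n m :: nat
    and Q :: "real mat"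
    and c :: "real vec"
    and A :: "real mat"
    and b :: "real vec"
    and tol :: real
begin

definition theta :: real where "theta = 0.3"
definition beta :: real where "beta = theta"
definition sigma :: real where "sigma = 1 - beta / sqrt (2 * real n)"
definition N :: nat where "N = 3 * n + m"
definition C_Hf :: real where "C_Hf = 10"
definition C_q :: real where
  "C_q = spectral_norm Q * real n + norm2 c * sqrt (real n)"
definition omega :: real where
  "omega = Min {tol / (2 * real n), tol\<^sup>2 / (16 * (4 * C_q + real n)), 1}"
definition C_lambda :: real where
  "C_lambda = (spectral_norm A * sqrt (real n) + norm2 b) / omega"
definition C_Dmu :: real where
  "C_Dmu = (omega + spectral_norm Q) * sqrt (real n) + norm2 c + spectral_norm A * C_lambda"
definition tau_A :: real where
  "tau_A = max
     (1 / 4 * spectral_norm (Q + omega \<cdot>\<^sub>m 1\<^sub>m n + (1 / omega) \<cdot>\<^sub>m (transpose_mat A * A)))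
     (4 * norm2 (c - (1 / omega) \<cdot>\<^sub>v (transpose_mat A *\<^sub>v b)))"
definition tau_E :: real where
  "tau_E = tol\<^sup>2 * omega / (48 * real n * (max (spectral_norm A) C_q)\<^sup>2)"
definition C_mu :: real where
  "C_mu = sqrt (2 * real n) * (C_Dmu + (1 + theta) * tau_A)"
definition C_z :: real where
  "C_z = sqrt (real n + C_lambda\<^sup>2 + C_mu\<^sup>2) + 0.1"
definition c_gap :: real where
  "c_gap = (1 - theta) / (1 + C_z) * (sigma * tau_E / 2)"
definition C_DF :: real where
  "C_DF = spectral_norm Q + 2 * omega + 2 * frobenius_norm A + 4 + 4 * C_z"
definition C_DFinv :: real where
  "C_DFinv = 1 / c_gap * max (1 / omega) (C_z / c_gap)"
definition kappa_DF :: real where "kappa_DF = C_DF * C_DFinv"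
definition C_dF :: real where "C_dF = C_DF"
definition C_dDF :: real where "C_dDF = 2"
definition C_dDz :: real where "C_dDz = 2 * kappa_DF"
definition C_nu :: real where
  "C_nu = max (2 * C_dDz * (C_dF * C_DFinv + 2 / omega * C_dDF * C_z)) (1 + C_DFinv * C_dF)"
definition nu2 :: real where
  "nu2 = Min {0.1, c_gap / C_nu, omega / (2 * C_dDF * kappa_DF),
              theta * sigma * tau_E / (2 * C_nu * C_dF)}"
definition rho :: real where
  "rho = 1 / (4 * sqrt (real N)) * (nu2 / (spectral_norm A / omega + 1 + 8 * tau_A))"
definition K :: nat where
  "K = nat \<lceil>log 2 (1 + log 2 (C_Hf / rho))\<rceil>"
definition M :: nat where
  "M = nat \<lceil>(ln tau_E - ln tau_A) / ln sigma\<rceil>"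

definition f :: "real vec \<Rightarrow> real" where
  "f x = 1 / tau_A * (quad_obj Q c x + omega / 2 * (norm2 x)\<^sup>2
            + 1 / (2 * omega) * (norm2 (A *\<^sub>v x - b))\<^sup>2)
         - (\<Sum>j<n. ln (1 + x $ j) + ln (1 - x $ j))"

text \<open>A point \<open>z = (x, \<lambda>, \<mu>\<^sub>L, \<mu>\<^sub>R)\<close> is represented by the concatenated vector of dimension \<open>N\<close>.\<close>

definition F :: "real \<Rightarrow> real vec \<Rightarrow> real vec" where
  "F \<tau> z = (let
       x = vec_block 0 n z;
       lam = vec_block n m z;
       muL = vec_block (n + m) n z;
       muR = vec_block (n + m + n) n z
     in
       (Q *\<^sub>v x + omega \<cdot>\<^sub>v x + c - transpose_mat A *\<^sub>v lam - muL + muR) @\<^sub>v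
       (A *\<^sub>v x - b + omega \<cdot>\<^sub>v lam) @\<^sub>v
       (times_cw muL (ones_vec n + x) - \<tau> \<cdot>\<^sub>v ones_vec n) @\<^sub>v
       (times_cw muR (ones_vec n - x) - \<tau> \<cdot>\<^sub>v ones_vec n))"

text \<open>The Jacobian does not depend on \<open>\<tau>\<close>; see \<open>DF_eq\<close> below.\<close>

definition DF :: "real vec \<Rightarrow> real mat" where
  "DF z = jacobian (F 0) z"

lemma dim_F:
  assumes "A \<in> carrier_mat m n" "b \<in> carrier_vec m"
  shows "dim_vec (F \<tau> z) = N"
  using assms by (simp add: F_def N_def Let_def vec_block_def times_cw_def ones_vec_def)

lemma DF_eq:
  assumes A: "A \<in> carrier_mat m n" and b: "b \<in> carrier_vec m"
  shows "jacobian (F \<tau>) z = DF z"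
proof -
  have shift: "F \<tau> w $ i = F 0 w $ i - (if i < n + m then 0 else \<tau>)" if "i < N" for w i
    using that A b
    by (auto simp: F_def N_def Let_def vec_block_def times_cw_def ones_vec_def)
  have deriv_shift: "deriv (\<lambda>t. h t - a) x = deriv h x" for h :: "real \<Rightarrow> real" and a x
  proof -
    have "((\<lambda>t. h t - a) has_real_derivative D) (at x) \<longleftrightarrow> (h has_real_derivative D) (at x)" for D
      using DERIV_diff[OF _ DERIV_const, of h D x UNIV a]
        DERIV_add[OF _ DERIV_const, of "\<lambda>t. h t - a" D x UNIV a] by auto
    then show ?thesis by (simp add: deriv_def)
  qed
  show ?thesis
    unfolding DF_def jacobian_def dim_F[OF A b]
    by (rule cong_mat) (simp_all add: shift deriv_shift)
qed

text \<open>From \<open>r = (r\<^sup>1, r\<^sup>2, r\<^sup>3, r\<^sup>4)\<close> to \<open>(r\<^sup>1, r\<^sup>2, 0, 0)\<close>.\<close>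

definition linear_part :: "real vec \<Rightarrow> real vec" where
  "linear_part r = vec_block 0 (n + m) r @\<^sub>v 0\<^sub>v (2 * n)"

text \<open>
  A step is undefined (\<^const>\<open>None\<close>) if its linear system is singular, if a componentwise quotient
  has a vanishing denominator, or if a derivative of \<open>f\<close> is requested outside of \<open>Omega n\<close>. The last
  test is needed because \<^const>\<open>ln\<close> is a total function.
\<close>

primrec centering :: "nat \<Rightarrow> (real vec \<times> nat list) option" where
  "centering 0 = Some (0\<^sub>v n, [])"
| "centering (Suc k) = do {
     (x, ds) \<leftarrow> centering k;
     if x \<in> Omega n then do {
       (d, ds) \<leftarrow> solve (hessian f x) (gradient f x) ds;
       Some (x - d, ds)
     } else None
   }"

definition initialization :: "(real vec \<times> nat list) option" where
  "initialization = do {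
     (xK, ds) \<leftarrow> centering K;
     muL \<leftarrow> divide_cw tau_A (ones_vec n + xK);
     muR \<leftarrow> divide_cw tau_A (ones_vec n - xK);
     let zc = xK @\<^sub>v ((- (1 / omega)) \<cdot>\<^sub>v (A *\<^sub>v xK - b)) @\<^sub>v muL @\<^sub>v muR;
     (d, ds) \<leftarrow> solve (DF zc) (linear_part (F tau_A zc)) ds;
     Some (zc - d, ds)
   }"

definition path_step :: "real \<Rightarrow> real vec \<Rightarrow> nat list \<Rightarrow> (real vec \<times> nat list) option" where
  "path_step \<tau>' z ds = do {
     (d, ds) \<leftarrow> solve (DF z) (F \<tau>' z) ds;
     let z1 = z - d;
     (d, ds) \<leftarrow> solve (DF z1) (F \<tau>' z1) ds;
     let z2 = z1 - d;
     (d, ds) \<leftarrow> solve (DF z2) (linear_part (F \<tau>' z2)) ds;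
     Some (z2 - d, ds)
   }"

text \<open>
  The first argument is the number of iterations still allowed, \<open>it\<close> the number of iterations (of
  both loops) performed so far.
\<close>

primrec path_following ::
    "nat \<Rightarrow> real \<Rightarrow> real vec \<Rightarrow> nat \<Rightarrow> nat list \<Rightarrow> (real vec \<times> nat \<times> nat list) option" where
  "path_following 0 \<tau> z it ds = Some (z, it, ds)"
| "path_following (Suc k) \<tau> z it ds = do {
     let \<tau>' = sigma * \<tau>;
     (z', ds) \<leftarrow> path_step \<tau>' z ds;
     if \<tau>' \<le> tau_E then Some (z', Suc it, ds) else path_following k \<tau>' z' (Suc it) ds
   }"

text \<open>
  Returns the computed vector, the number of iterations and the list of the dimensions of the
  linear systems that were solved.
\<close>

definition algorithm :: "(real vec \<times> nat \<times> nat list) option" where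
  "algorithm = do {
     (z, ds) \<leftarrow> initialization;
     (z, it, ds) \<leftarrow> path_following M tau_A z K ds;
     Some (vec_block 0 n z, it, ds)
   }"

definition L :: real where
  "L = ln (1 + spectral_norm Q + norm2 c + spectral_norm A + norm2 b) + ln (real (n + m)) - ln tol"


end

end

theory Submission
  imports Defs "Jordan_Normal_Form.Determinant"
begin

text \<open>
  Everything rests on the fact that, in exact arithmetic, a Newton step reproduces affine equations
  exactly. What remains of a step is the error of the non-affine part, and this is explicit.

  In the centering phase the gradient of \<^term>\<open>ipm.f\<close> is an affine function plus the gradient of the
  logarithmic barrier. After a step \<open>d\<close> only the Taylor remainder of the barrier survives, whose
  components are \<open>(d / s)\<^sup>2 / (s - d)\<close> for the slacks \<open>s = 1 + x\<close> and (with \<open>- d\<close>) \<open>s = 1 - x\<close>. Testing it with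
  the next step \<open>e\<close> bounds the local norm \<open>\<parallel>e / s\<parallel>\<close> at the new point by \<open>\<parallel>(d / s)\<^sup>2\<parallel>\<close> at the old one
  (\<open>centered_newton_step\<close>). As \<open>\<tau>\<^sub>A\<close> is chosen such that the squared local norm of the first step is at
  most \<open>1 / 32\<close> (\<open>centered_0\<close>), this bound persists. The correction that follows the centering phase
  has the next Newton step of the barrier function as its primal part; it annihilates the two linear
  residuals and leaves complementarity products within \<open>\<theta> \<tau>\<^sub>A\<close> of \<open>\<tau>\<^sub>A\<close> (\<open>initialization_Some\<close>).

  In the path-following phase the linear residuals stay zero, so a Newton direction satisfies
  \<open>\<Sum> \<Delta>s \<Delta>\<mu> \<ge> 0\<close>, and the new complementarity products differ from the target by exactly \<open>\<Delta>s \<Delta>\<mu>\<close>. The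
  classical bound \<open>\<parallel>p q\<parallel> \<le> \<parallel>p + q\<parallel>\<^sup>2 / \<surd>8\<close> for \<open>\<Sum> p q \<ge> 0\<close> (\<open>sum_square_prod_le\<close>) shows that the first of the two
  Newton steps already returns to the neighbourhood of width \<open>\<theta>\<close> around the reduced target \<open>\<sigma> \<tau>\<close>; the
  final correction is zero (\<open>path_step_Some\<close>).

  A point of that neighbourhood satisfies the optimality conditions of the penalized objective
  \<open>\<phi>(x) = q(x) + \<omega> / 2 \<parallel>x\<parallel>\<^sup>2 + \<parallel>A x - b\<parallel>\<^sup>2 / (2 \<omega>)\<close> on the box up to complementarity, hence minimizes \<open>\<phi>\<close> up to
  \<open>2.6 n \<tau>\<close> by convexity (\<open>phi_gap\<close>). The choices of \<open>\<omega>\<close> and \<open>\<tau>\<^sub>E\<close> turn this into the two accuracy claims,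
  either directly or, if the data are so small that \<open>\<tau>\<^sub>E\<close> is not small, because \<open>q\<close> or \<open>A x - b\<close> hardly
  varies on the box (\<open>objective_accuracy\<close>, \<open>residual_accuracy\<close>).

  For the complexity, \<open>L\<close> is the logarithm of a number that is at least 2 and that bounds the data.
  All parameters and the relevant reciprocals are at most a fixed power of it, so their logarithms are
  \<open>O(L)\<close>; moreover \<open>- ln \<sigma> \<ge> \<beta> / \<surd>(2 n)\<close> (\<open>K_le\<close>, \<open>M_le\<close>).
\<close>

section \<open>Newton steps for complementarity products\<close>

text \<open>
  The classical estimate behind short-step interior point methods. The positive products sum up to at
  most \<open>\<parallel>p + q\<parallel>\<^sup>2 / 4\<close>, and the negative ones are dominated by them.
\<close>

lemma sum_square_prod_le:
  fixes p q :: "'a \<Rightarrow> real"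
  assumes fin: "finite I" and nonneg: "0 \<le> (\<Sum>i\<in>I. p i * q i)"
  shows "(\<Sum>i\<in>I. (p i * q i)\<^sup>2) \<le> (\<Sum>i\<in>I. (p i + q i)\<^sup>2)\<^sup>2 / 8"
proof -
  define P where "P = {i\<in>I. p i * q i \<ge> 0}"
  define R where "R = {i\<in>I. p i * q i < 0}"
  define S where "S = (\<Sum>i\<in>I. (p i + q i)\<^sup>2)"
  have finPR: "finite P" "finite R" "P \<inter> R = {}" "I = P \<union> R"
    using fin by (auto simp: P_def R_def)
  let ?p = "\<Sum>i\<in>P. p i * q i" and ?r = "\<Sum>i\<in>R. - (p i * q i)"
  have sq: "(\<Sum>i\<in>J. (u i)\<^sup>2) \<le> (\<Sum>i\<in>J. u i)\<^sup>2" if "finite J" "\<And>i. i \<in> J \<Longrightarrow> 0 \<le> u i" for J and u :: "'a \<Rightarrow> real"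
    using that
  proof (induction J rule: finite_induct)
    case (insert x J)
    have "0 \<le> u x * sum u J" using insert by (intro mult_nonneg_nonneg sum_nonneg) auto
    with insert show ?case by (simp add: power2_sum)
  qed simp
  have "?p \<le> (\<Sum>i\<in>P. (p i + q i)\<^sup>2 / 4)"
  proof (rule sum_mono)
    fix i
    have "0 \<le> (p i - q i)\<^sup>2" by simp
    then show "p i * q i \<le> (p i + q i)\<^sup>2 / 4" by (simp add: power2_eq_square algebra_simps)
  qed
  also have "\<dots> = (\<Sum>i\<in>P. (p i + q i)\<^sup>2) / 4" by (simp add: sum_divide_distrib)
  also have "\<dots> \<le> S / 4"
    unfolding S_def using finPR fin by (intro divide_right_mono sum_mono2) auto
  finally have pS: "?p \<le> S / 4" .
  have p0: "0 \<le> ?p" by (rule sum_nonneg) (simp add: P_def)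
  have r0: "0 \<le> ?r" by (rule sum_nonneg) (simp add: R_def)
  have "(\<Sum>i\<in>I. p i * q i) = ?p - ?r"
    using sum.union_disjoint[OF finPR(1-3), of "\<lambda>i. p i * q i"] by (simp add: finPR(4)[symmetric] sum_negf)
  with nonneg have rp: "?r \<le> ?p" by simp
  have "(\<Sum>i\<in>I. (p i * q i)\<^sup>2) = (\<Sum>i\<in>P. (p i * q i)\<^sup>2) + (\<Sum>i\<in>R. (- (p i * q i))\<^sup>2)"
    using sum.union_disjoint[OF finPR(1-3), of "\<lambda>i. (p i * q i)\<^sup>2"] by (simp add: finPR(4)[symmetric])
  also have "\<dots> \<le> ?p\<^sup>2 + ?r\<^sup>2"
    using finPR(1,2) by (intro add_mono sq) (auto simp: P_def R_def)
  also have "\<dots> \<le> (S / 4)\<^sup>2 + (S / 4)\<^sup>2"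
    using p0 r0 pS rp by (intro add_mono power_mono) auto
  finally show ?thesis by (simp add: S_def power2_eq_square)
qed

text \<open>
  A Newton step \<open>(ds, dmu)\<close> towards \<open>mu s = tau\<close> is subtracted from \<open>(s, mu)\<close>; the left-hand side is the squared
  residual after the step. The sequences of the preceding lemma are \<open>ds\<close> and \<open>dmu\<close>, scaled to a common unit.
\<close>

lemma newton_products:
  fixes s mu ds dmu :: "'a \<Rightarrow> real"
  assumes fin: "finite I"
    and pos: "\<And>i. i \<in> I \<Longrightarrow> 0 < s i" "\<And>i. i \<in> I \<Longrightarrow> 0 < mu i"
    and eq: "\<And>i. i \<in> I \<Longrightarrow> mu i * ds i + s i * dmu i = mu i * s i - tau"
    and mono: "0 \<le> (\<Sum>i\<in>I. ds i * dmu i)"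
    and kap: "0 < kap" "\<And>i. i \<in> I \<Longrightarrow> kap \<le> mu i * s i"
    and res: "(\<Sum>i\<in>I. (mu i * s i - tau)\<^sup>2) \<le> eta"
  shows "(\<Sum>i\<in>I. (ds i * dmu i)\<^sup>2) \<le> (eta / kap)\<^sup>2 / 8"
proof -
  define p q where "p i = sqrt (mu i / s i) * ds i" and "q i = sqrt (s i / mu i) * dmu i" for i
  have pq: "p i * q i = ds i * dmu i" if "i \<in> I" for i
  proof -
    have "sqrt (mu i / s i) * sqrt (s i / mu i) = 1"
      using pos[OF that] by (simp add: real_sqrt_mult[symmetric])
    then show ?thesis unfolding p_def q_def by (metis (no_types, opaque_lifting) mult.assoc mult.left_commute mult_1)
  qed
  have sum: "(p i + q i)\<^sup>2 = (mu i * s i - tau)\<^sup>2 / (mu i * s i)" if "i \<in> I" for i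
  proof -
    note ps = pos[OF that]
    have "(p i + q i)\<^sup>2 = (sqrt (mu i / s i))\<^sup>2 * (ds i)\<^sup>2 + (sqrt (s i / mu i))\<^sup>2 * (dmu i)\<^sup>2 + 2 * (p i * q i)"
      by (simp add: p_def q_def power2_sum power_mult_distrib)
    also have "\<dots> = mu i / s i * (ds i)\<^sup>2 + s i / mu i * (dmu i)\<^sup>2 + 2 * (ds i * dmu i)"
      using ps by (simp add: pq[OF that])
    also have "\<dots> = (mu i * ds i + s i * dmu i)\<^sup>2 / (mu i * s i)"
      using ps by (simp add: field_simps power2_eq_square)
    finally show ?thesis by (simp add: eq[OF that])
  qed
  have eta: "0 \<le> eta" by (rule order_trans[OF sum_nonneg res]) simp
  have "(\<Sum>i\<in>I. (p i + q i)\<^sup>2) \<le> (\<Sum>i\<in>I. (mu i * s i - tau)\<^sup>2 / kap)"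
    using kap by (intro sum_mono) (auto simp: sum intro!: divide_left_mono mult_pos_pos pos)
  also have "\<dots> \<le> eta / kap"
    using kap res by (simp add: sum_divide_distrib[symmetric] divide_right_mono)
  finally have "(\<Sum>i\<in>I. (p i + q i)\<^sup>2) \<le> eta / kap" .
  then have "(\<Sum>i\<in>I. (p i + q i)\<^sup>2)\<^sup>2 \<le> (eta / kap)\<^sup>2"
    by (intro power_mono sum_nonneg) auto
  moreover have "(\<Sum>i\<in>I. (p i * q i)\<^sup>2) \<le> (\<Sum>i\<in>I. (p i + q i)\<^sup>2)\<^sup>2 / 8"
    using fin mono by (intro sum_square_prod_le) (simp_all add: pq cong: sum.cong)
  ultimately show ?thesis by (simp add: pq cong: sum.cong)
qed

text \<open>
  The full step keeps both factors positive: they cannot both become nonpositive because of the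
  linearized equation, and their product stays positive.
\<close>

lemma newton_positive:
  fixes s mu ds dmu tau :: real
  assumes "0 < s" "0 < mu" "mu * ds + s * dmu = mu * s - tau" "\<bar>ds * dmu\<bar> < tau"
  shows "0 < s - ds" "0 < mu - dmu" "(mu - dmu) * (s - ds) - tau = ds * dmu"
proof -
  have prod: "(mu - dmu) * (s - ds) = tau + ds * dmu"
    using assms(3) by (simp add: algebra_simps)
  then have pos: "0 < (mu - dmu) * (s - ds)" using assms(4) by linarith
  have "\<not> (mu - dmu < 0 \<and> s - ds < 0)"
  proof
    assume "mu - dmu < 0 \<and> s - ds < 0"
    then have "mu * s \<le> mu * ds" "s * mu \<le> s * dmu" using assms by (auto intro!: mult_left_mono)
    moreover have "0 < mu * s" "0 < tau" using assms by auto
    ultimately show False using assms(3) by (simp add: mult.commute)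
  qed
  with pos show "0 < s - ds" "0 < mu - dmu" by (auto simp: zero_less_mult_iff)
  show "(mu - dmu) * (s - ds) - tau = ds * dmu" using prod by simp
qed

text \<open>
  The exact Taylor remainder of the derivative of the logarithm, up to sign.
\<close>

lemma inverse_remainder:
  fixes s d :: real
  assumes "0 < s" "0 < s - d"
  shows "1 / (s - d) = 1 / s + d / s\<^sup>2 + (d / s)\<^sup>2 / (s - d)"
  using assms by (simp add: divide_simps power2_eq_square) (simp add: algebra_simps)

section \<open>Norms and linear systems\<close>

lemma norm2_eq_L2_set: "norm2 v = L2_set (\<lambda>i. v $ i) {..<dim_vec v}"
  by (simp add: norm2_def L2_set_def)

lemma norm2_nonneg [simp]: "0 \<le> norm2 v"
  by (simp add: norm2_def sum_nonneg)

lemma norm2_sq: "(norm2 v)\<^sup>2 = (\<Sum>i<dim_vec v. (v $ i)\<^sup>2)"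
  by (simp add: norm2_def sum_nonneg)

lemma scalar_prod_sum:
  "v \<in> carrier_vec n \<Longrightarrow> u \<bullet> v = (\<Sum>i<n. u $ i * v $ i)"
  by (auto simp: scalar_prod_def atLeast0LessThan)

lemma scalar_prod_self: "v \<bullet> v = (norm2 v)\<^sup>2"
  unfolding norm2_sq by (simp add: scalar_prod_def atLeast0LessThan power2_eq_square)

lemma norm2_zero [simp]: "norm2 (0\<^sub>v k) = 0"
  by (simp add: norm2_def)

lemma norm2_eq_0D: "norm2 v = 0 \<Longrightarrow> v \<in> carrier_vec k \<Longrightarrow> v = 0\<^sub>v k"
  by (rule eq_vecI) (auto simp: norm2_def sum_nonneg_eq_0_iff)

lemma norm2_smult: "norm2 (a \<cdot>\<^sub>v v) = \<bar>a\<bar> * norm2 v"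
  by (simp add: norm2_def power_mult_distrib sum_distrib_left[symmetric] real_sqrt_mult)

lemma norm2_triangle:
  assumes "u \<in> carrier_vec k" "v \<in> carrier_vec k"
  shows "norm2 (u + v) \<le> norm2 u + norm2 v"
  using L2_set_triangle_ineq[of "\<lambda>i. u $ i" "\<lambda>i. v $ i" "{..<k}"] assms
  by (auto simp: norm2_eq_L2_set L2_set_def)

lemma norm2_uminus: "norm2 (- v) = norm2 v"
  by (simp add: norm2_def)

lemma norm2_triangle_minus:
  assumes "u \<in> carrier_vec k" "v \<in> carrier_vec k"
  shows "norm2 (u - v) \<le> norm2 u + norm2 v"
proof -
  have "u - v = u + - v" using assms by auto
  then show ?thesis using norm2_triangle[of u k "- v"] assms by (simp add: norm2_uminus)
qed

lemma scalar_prod_le_norm2: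
  assumes "u \<in> carrier_vec k" "v \<in> carrier_vec k"
  shows "\<bar>u \<bullet> v\<bar> \<le> norm2 u * norm2 v"
proof -
  have "\<bar>u \<bullet> v\<bar> \<le> (\<Sum>i<k. \<bar>u $ i\<bar> * \<bar>v $ i\<bar>)"
    using assms by (auto simp: scalar_prod_sum abs_mult intro: order_trans[OF sum_abs])
  also have "\<dots> \<le> norm2 u * norm2 v"
    using L2_set_mult_ineq[of "\<lambda>i. u $ i" "\<lambda>i. v $ i" "{..<k}"] assms
    by (auto simp: norm2_eq_L2_set)
  finally show ?thesis .
qed

lemma mult_line:
  fixes M :: "real mat"
  assumes "M \<in> carrier_mat r k" "x \<in> carrier_vec k" "u \<in> carrier_vec k"
  shows "M *\<^sub>v (x + t \<cdot>\<^sub>v u) = M *\<^sub>v x + t \<cdot>\<^sub>v (M *\<^sub>v u)"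
  using assms by (simp add: mult_add_distrib_mat_vec mult_mat_vec)

lemma norm2_sq_line:
  assumes "x \<in> carrier_vec k" "u \<in> carrier_vec k"
  shows "(norm2 (x + t \<cdot>\<^sub>v u))\<^sup>2 = (norm2 x)\<^sup>2 + 2 * t * (u \<bullet> x) + t\<^sup>2 * (norm2 u)\<^sup>2"
  using assms
  by (simp add: norm2_sq scalar_prod_sum[of _ k] power2_sum sum.distrib sum_distrib_left
      power_mult_distrib mult.assoc algebra_simps)

lemma smult_mat_mult_vec:
  fixes B :: "real mat"
  assumes "B \<in> carrier_mat r k" "v \<in> carrier_vec k"
  shows "(a \<cdot>\<^sub>m B) *\<^sub>v v = a \<cdot>\<^sub>v (B *\<^sub>v v)"
  using assms by (intro eq_vecI) auto

lemma frobenius_norm_nonneg: "0 \<le> frobenius_norm M"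
  by (simp add: frobenius_norm_def sum_nonneg)

lemma norm2_mult_le_frobenius:
  assumes M: "M \<in> carrier_mat r k" and v: "v \<in> carrier_vec k"
  shows "norm2 (M *\<^sub>v v) \<le> frobenius_norm M * norm2 v"
proof (rule power2_le_imp_le)
  have "(norm2 (M *\<^sub>v v))\<^sup>2 = (\<Sum>i<r. (row M i \<bullet> v)\<^sup>2)"
    using M v by (simp add: norm2_sq)
  also have "\<dots> \<le> (\<Sum>i<r. (norm2 (row M i) * norm2 v)\<^sup>2)"
  proof (rule sum_mono)
    fix i
    assume "i \<in> {..<r}"
    then have "\<bar>row M i \<bullet> v\<bar> \<le> norm2 (row M i) * norm2 v"
      using M v by (intro scalar_prod_le_norm2) auto
    then show "(row M i \<bullet> v)\<^sup>2 \<le> (norm2 (row M i) * norm2 v)\<^sup>2"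
      by (metis abs_ge_zero power2_abs power_mono)
  qed
  also have "\<dots> = (\<Sum>i<r. (norm2 (row M i))\<^sup>2) * (norm2 v)\<^sup>2"
    by (simp add: power_mult_distrib sum_distrib_right)
  also have "(\<Sum>i<r. (norm2 (row M i))\<^sup>2) = (frobenius_norm M)\<^sup>2"
    using M by (auto simp: frobenius_norm_def norm2_sq sum_nonneg intro!: sum.cong)
  finally show "(norm2 (M *\<^sub>v v))\<^sup>2 \<le> (frobenius_norm M * norm2 v)\<^sup>2"
    by (simp add: power_mult_distrib)
qed (simp add: frobenius_norm_nonneg)

lemma norm2_mult_le_spectral:
  assumes M: "M \<in> carrier_mat r k" and v: "v \<in> carrier_vec k"
  shows "norm2 (M *\<^sub>v v) \<le> spectral_norm M * norm2 v"
proof (cases "norm2 v = 0")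
  case True
  then have "v = 0\<^sub>v k" using v by (intro norm2_eq_0D)
  then have "M *\<^sub>v v = 0\<^sub>v r" using M by auto
  with True show ?thesis by simp
next
  case False
  let ?S = "{norm2 (M *\<^sub>v v) | v. v \<in> carrier_vec (dim_col M) \<and> norm2 v \<le> 1}"
  let ?w = "(1 / norm2 v) \<cdot>\<^sub>v v"
  have bdd: "bdd_above ?S"
  proof (rule bdd_aboveI)
    fix y
    assume "y \<in> ?S"
    then obtain u where u: "u \<in> carrier_vec k" "norm2 u \<le> 1" "y = norm2 (M *\<^sub>v u)" using M by auto
    have "y \<le> frobenius_norm M * norm2 u" using norm2_mult_le_frobenius[OF M u(1)] u by simp
    also have "\<dots> \<le> frobenius_norm M * 1" using u by (intro mult_left_mono frobenius_norm_nonneg) auto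
    finally show "y \<le> frobenius_norm M" by simp
  qed
  have "norm2 (M *\<^sub>v ?w) \<le> spectral_norm M"
    unfolding spectral_norm_def using M v False
    by (intro cSup_upper bdd) (auto simp: norm2_smult intro!: exI[of _ ?w])
  then have "norm2 (M *\<^sub>v v) / norm2 v \<le> spectral_norm M"
    using M v by (simp add: mult_mat_vec norm2_smult)
  with False show ?thesis by (simp add: field_simps less_le)
qed

lemma spectral_norm_le:
  assumes M: "M \<in> carrier_mat r k" and "0 \<le> C"
    and le: "\<And>v. v \<in> carrier_vec k \<Longrightarrow> norm2 (M *\<^sub>v v) \<le> C * norm2 v"
  shows "spectral_norm M \<le> C"
  unfolding spectral_norm_def
proof (rule cSup_least)
  show "{norm2 (M *\<^sub>v v) | v. v \<in> carrier_vec (dim_col M) \<and> norm2 v \<le> 1} \<noteq> {}"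
    by (auto intro!: exI[of _ "0\<^sub>v (dim_col M)"])
  fix y
  assume "y \<in> {norm2 (M *\<^sub>v v) | v. v \<in> carrier_vec (dim_col M) \<and> norm2 v \<le> 1}"
  then obtain u where u: "u \<in> carrier_vec k" "norm2 u \<le> 1" "y = norm2 (M *\<^sub>v u)" using M by auto
  have "y \<le> C * norm2 u" using le u by simp
  also have "\<dots> \<le> C * 1" using u \<open>0 \<le> C\<close> by (intro mult_left_mono) auto
  finally show "y \<le> C" by simp
qed

lemma norm2_unit_vec: "i < k \<Longrightarrow> norm2 (unit_vec k i) = 1"
proof -
  assume "i < k"
  then have "(norm2 (unit_vec k i))\<^sup>2 = 1"
    by (simp add: scalar_prod_self[symmetric])
  then show ?thesis using norm2_nonneg[of "unit_vec k i"] by (auto simp: power2_eq_1_iff)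
qed

lemma spectral_norm_nonneg:
  assumes "M \<in> carrier_mat r k" "0 < k"
  shows "0 \<le> spectral_norm M"
proof -
  have "0 \<le> norm2 (M *\<^sub>v unit_vec k 0)" by simp
  also have "\<dots> \<le> spectral_norm M * norm2 (unit_vec k 0)"
    using assms by (intro norm2_mult_le_spectral) auto
  finally show ?thesis using assms by (simp add: norm2_unit_vec)
qed

lemma norm2_col_le_spectral:
  assumes M: "M \<in> carrier_mat r k" and "j < k"
  shows "norm2 (col M j) \<le> spectral_norm M"
proof -
  have "M *\<^sub>v unit_vec k j = col M j" using assms by (auto intro!: eq_vecI)
  then show ?thesis
    using norm2_mult_le_spectral[OF M, of "unit_vec k j"] assms by (simp add: norm2_unit_vec)
qed

lemma spectral_norm_eq_0D:
  assumes M: "M \<in> carrier_mat r k" and "spectral_norm M = 0"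
  shows "M = 0\<^sub>m r k"
proof (rule eq_matI)
  fix i j
  assume "i < dim_row (0\<^sub>m r k)" "j < dim_col (0\<^sub>m r k)"
  then have ij: "i < r" "j < k" by auto
  have "norm2 (col M j) = 0" using norm2_col_le_spectral[OF M ij(2)] assms(2) norm2_nonneg[of "col M j"] by linarith
  then have "col M j = 0\<^sub>v r" using M by (intro norm2_eq_0D) auto
  then have "col M j $ i = 0" using ij by simp
  then show "M $$ (i, j) = 0\<^sub>m r k $$ (i, j)" using M ij by simp
qed (use M in auto)

lemma frobenius_le_spectral:
  assumes M: "M \<in> carrier_mat r k"
  shows "frobenius_norm M \<le> sqrt (real k) * spectral_norm M"
proof (cases "k = 0")
  case True
  then show ?thesis using M by (simp add: frobenius_norm_def)
next
  case False
  have "(frobenius_norm M)\<^sup>2 = (\<Sum>j<k. \<Sum>i<r. (M $$ (i, j))\<^sup>2)"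
    using M sum.swap[of "\<lambda>i j. (M $$ (i, j))\<^sup>2" "{..<k}" "{..<r}"]
    by (simp add: frobenius_norm_def sum_nonneg)
  also have "\<dots> = (\<Sum>j<k. (norm2 (col M j))\<^sup>2)"
    using M by (auto simp: norm2_sq intro!: sum.cong)
  also have "\<dots> \<le> (\<Sum>j<k. (spectral_norm M)\<^sup>2)"
    using norm2_col_le_spectral[OF M] by (intro sum_mono power_mono) auto
  also have "\<dots> = (sqrt (real k) * spectral_norm M)\<^sup>2" by (simp add: power_mult_distrib)
  finally show ?thesis
    by (rule power2_le_imp_le) (use False M spectral_norm_nonneg[of M r k] in simp)
qed

lemma norm2_transpose_mult_le:
  assumes M: "M \<in> carrier_mat r k" and k: "0 < k" and u: "u \<in> carrier_vec r"
  shows "norm2 (transpose_mat M *\<^sub>v u) \<le> spectral_norm M * norm2 u"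
proof -
  let ?w = "transpose_mat M *\<^sub>v u"
  have w: "?w \<in> carrier_vec k" using M u by simp
  have "norm2 ?w * norm2 ?w = ?w \<bullet> ?w" by (simp add: scalar_prod_self power2_eq_square)
  also have "\<dots> = u \<bullet> (M *\<^sub>v ?w)" by (rule transpose_vec_mult_scalar[OF M w u])
  also have "\<dots> \<le> norm2 u * norm2 (M *\<^sub>v ?w)"
    using scalar_prod_le_norm2[of u r "M *\<^sub>v ?w"] M u w by simp
  also have "\<dots> \<le> norm2 u * (spectral_norm M * norm2 ?w)"
    using norm2_mult_le_spectral[OF M w] by (intro mult_left_mono) auto
  finally have le: "norm2 ?w * norm2 ?w \<le> (spectral_norm M * norm2 u) * norm2 ?w" by (simp add: ac_simps)
  show ?thesis
  proof (cases "norm2 ?w = 0")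
    case True
    then show ?thesis using spectral_norm_nonneg[OF M k] by simp
  next
    case False
    then have "0 < norm2 ?w" using norm2_nonneg[of ?w] by linarith
    with le show ?thesis by simp
  qed
qed

lemma norm_max_iff:
  assumes "0 < dim_vec v"
  shows "norm_max v < a \<longleftrightarrow> (\<forall>i<dim_vec v. \<bar>v $ i\<bar> < a)"
    and "norm_max v \<le> a \<longleftrightarrow> (\<forall>i<dim_vec v. \<bar>v $ i\<bar> \<le> a)"
proof -
  have ne: "(\<lambda>i. \<bar>v $ i\<bar>) ` {..<dim_vec v} \<noteq> {}" using assms by auto
  show "norm_max v < a \<longleftrightarrow> (\<forall>i<dim_vec v. \<bar>v $ i\<bar> < a)"
    unfolding norm_max_def by (subst Max_less_iff[OF _ ne]) auto
  show "norm_max v \<le> a \<longleftrightarrow> (\<forall>i<dim_vec v. \<bar>v $ i\<bar> \<le> a)"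
    unfolding norm_max_def by (subst Max_le_iff[OF _ ne]) auto
qed

lemma Omega_iff: "0 < k \<Longrightarrow> x \<in> Omega k \<longleftrightarrow> x \<in> carrier_vec k \<and> (\<forall>i<k. -1 < x $ i \<and> x $ i < 1)"
  by (auto simp: Omega_def norm_max_iff abs_less_iff)

lemma Omega_closure_iff:
  "0 < k \<Longrightarrow> x \<in> Omega_closure k \<longleftrightarrow> x \<in> carrier_vec k \<and> (\<forall>i<k. -1 \<le> x $ i \<and> x $ i \<le> 1)"
  by (auto simp: Omega_closure_def norm_max_iff abs_le_iff)

lemma norm2_Omega_closure: "0 < k \<Longrightarrow> x \<in> Omega_closure k \<Longrightarrow> norm2 x \<le> sqrt (real k)"
proof -
  assume "0 < k" "x \<in> Omega_closure k"
  then have x: "x \<in> carrier_vec k" "\<And>i. i < k \<Longrightarrow> \<bar>x $ i\<bar> \<le> 1" by (auto simp: Omega_closure_iff)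
  have "(\<Sum>i<k. (x $ i)\<^sup>2) \<le> (\<Sum>i<k. 1)" using x(2) by (intro sum_mono) (simp add: abs_square_le_1)
  then show ?thesis using x(1) by (simp add: norm2_def)
qed

lemma solve_eq_Some:
  assumes M: "M \<in> carrier_mat k k" and r: "r \<in> carrier_vec k"
    and ker: "\<And>v. v \<in> carrier_vec k \<Longrightarrow> M *\<^sub>v v = 0\<^sub>v k \<Longrightarrow> v = 0\<^sub>v k"
  obtains d where "solve M r ds = Some (d, k # ds)" "d \<in> carrier_vec k" "M *\<^sub>v d = r"
proof -
  have "det M \<noteq> 0" using ker by (auto simp: det_0_iff_vec_prod_zero_field[OF M])
  then have "M \<in> Units (ring_mat TYPE(real) k ())" by (rule det_non_zero_imp_unit[OF M])
  then obtain B where B: "mat_inverse M = Some B"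
    using mat_inverse(1)[OF M, of "()"] by (cases "mat_inverse M") auto
  then have inv: "M * B = 1\<^sub>m k" "B \<in> carrier_mat k k" using mat_inverse(2)[OF M B] by auto
  have "M *\<^sub>v (B *\<^sub>v r) = (M * B) *\<^sub>v r" by (rule assoc_mult_mat_vec[OF M inv(2) r, symmetric])
  also have "\<dots> = r" unfolding inv(1) using r by simp
  finally have "M *\<^sub>v (B *\<^sub>v r) = r" .
  then show thesis
    using B M inv r by (intro that[of "B *\<^sub>v r"]) (simp_all add: solve_def del: assoc_mult_mat_vec)
qed

text \<open>An additive and homogeneous map is determined by its values on the unit vectors.\<close>

lemma linear_map_sum:
  fixes l :: "real vec \<Rightarrow> real"
  assumes add: "\<And>u v. u \<in> carrier_vec k \<Longrightarrow> v \<in> carrier_vec k \<Longrightarrow> l (u + v) = l u + l v"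
    and smult: "\<And>a u. u \<in> carrier_vec k \<Longrightarrow> l (a \<cdot>\<^sub>v u) = a * l u"
    and d: "d \<in> carrier_vec k"
  shows "l d = (\<Sum>j<k. l (unit_vec k j) * d $ j)"
proof -
  define w where "w p = vec k (\<lambda>i. if i < p then d $ i else 0)" for p
  have "l (w p) = (\<Sum>j<p. l (unit_vec k j) * d $ j)" if "p \<le> k" for p
    using that
  proof (induction p)
    case 0
    have "w 0 = 0 \<cdot>\<^sub>v d" using d by (auto simp: w_def)
    then show ?case using smult[OF d, of 0] by simp
  next
    case (Suc p)
    have "w (Suc p) = w p + (d $ p) \<cdot>\<^sub>v unit_vec k p"
      using Suc.prems d by (intro eq_vecI) (auto simp: w_def less_Suc_eq)
    then have "l (w (Suc p)) = l (w p) + d $ p * l (unit_vec k p)"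
      by (simp add: add smult w_def)
    with Suc show ?case by (simp add: mult.commute)
  qed
  moreover have "w k = d" using d by (auto simp: w_def)
  ultimately show ?thesis by force
qed

section \<open>Problem data and derivatives of the barrier function\<close>

text \<open>
  The hypotheses of the theorem on a problem instance.
\<close>

locale ipm_instance = ipm n m Q c A b tol
  for n m :: nat and Q :: "real mat" and c :: "real vec" and A :: "real mat"
    and b :: "real vec" and tol :: real +
  assumes n_pos: "0 < n"
    and m_pos: "0 < m"
    and psd: "sym_psd n Q"
    and c: "c \<in> carrier_vec n"
    and A: "A \<in> carrier_mat m n"
    and b: "b \<in> carrier_vec m"
    and tol_pos: "0 < tol"
    and tol_less_1: "tol < 1"
    and nonzero: "\<not> (A = 0\<^sub>m m n \<and> Q = 0\<^sub>m n n \<and> c = 0\<^sub>v n)"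
    and tau_less: "tau_E < tau_A"
begin

lemma Q: "Q \<in> carrier_mat n n"
  and Q_sym: "transpose_mat Q = Q"
  and Q_psd: "v \<in> carrier_vec n \<Longrightarrow> 0 \<le> v \<bullet> (Q *\<^sub>v v)"
  using psd by (auto simp: sym_psd_def)

lemma C_q_nonneg: "0 \<le> C_q"
  unfolding C_q_def using spectral_norm_nonneg[OF Q n_pos] by simp

lemma omega_pos: "0 < omega"
  unfolding omega_def using tol_pos n_pos C_q_nonneg by (auto intro!: divide_pos_pos mult_pos_pos add_nonneg_pos)

lemma omega_le: "omega \<le> tol / (2 * real n)" "omega \<le> tol\<^sup>2 / (16 * (4 * C_q + real n))" "omega \<le> 1"
  by (auto simp: omega_def)

lemma max_norm_pos: "0 < max (spectral_norm A) C_q"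
proof (rule ccontr)
  assume "\<not> ?thesis"
  then have 0: "spectral_norm A = 0" "C_q = 0"
    using C_q_nonneg spectral_norm_nonneg[OF A n_pos] by (auto simp: less_max_iff_disj not_less)
  have "0 \<le> spectral_norm Q * real n" "0 \<le> norm2 c * sqrt (real n)"
    using spectral_norm_nonneg[OF Q n_pos] by auto
  with 0(2) have "spectral_norm Q * real n = 0" "norm2 c * sqrt (real n) = 0"
    unfolding C_q_def by linarith+
  then have "spectral_norm Q = 0" "norm2 c = 0" using n_pos by auto
  with 0 have "A = 0\<^sub>m m n" "Q = 0\<^sub>m n n" "c = 0\<^sub>v n"
    using spectral_norm_eq_0D[OF A] spectral_norm_eq_0D[OF Q] norm2_eq_0D[OF _ c] by auto
  with nonzero show False by simp
qed

lemma tau_E_pos: "0 < tau_E"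
  unfolding tau_E_def using tol_pos omega_pos n_pos max_norm_pos
  by (intro divide_pos_pos mult_pos_pos zero_less_power) auto

lemma tau_A_pos: "0 < tau_A"
  using tau_E_pos tau_less by simp

text \<open>
  The penalized objective: \<open>f\<close> is \<^term>\<open>phi\<close> divided by \<open>tau_A\<close>, plus the barrier.
\<close>

definition phi :: "real vec \<Rightarrow> real" where
  "phi x = quad_obj Q c x + omega / 2 * (norm2 x)\<^sup>2 + 1 / (2 * omega) * (norm2 (A *\<^sub>v x - b))\<^sup>2"

text \<open>
  The Hessian of \<^term>\<open>phi\<close>, as a linear map.
\<close>

definition G :: "real vec \<Rightarrow> real vec" where
  "G u = Q *\<^sub>v u + omega \<cdot>\<^sub>v u + (1 / omega) \<cdot>\<^sub>v (transpose_mat A *\<^sub>v (A *\<^sub>v u))"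

text \<open>
  The gradient of \<^term>\<open>phi\<close>.
\<close>

definition grad_phi :: "real vec \<Rightarrow> real vec" where
  "grad_phi x = Q *\<^sub>v x + omega \<cdot>\<^sub>v x + c + (1 / omega) \<cdot>\<^sub>v (transpose_mat A *\<^sub>v (A *\<^sub>v x - b))"

lemma G_carrier [simp]: "u \<in> carrier_vec n \<Longrightarrow> G u \<in> carrier_vec n"
  using Q A by (auto simp: G_def)

lemma grad_phi_carrier [simp]: "u \<in> carrier_vec n \<Longrightarrow> grad_phi u \<in> carrier_vec n"
  using Q A b c by (auto simp: grad_phi_def)

lemma dim_G [simp]: "u \<in> carrier_vec n \<Longrightarrow> dim_vec (G u) = n"
  using G_carrier[of u] by (simp only: carrier_vec_def mem_Collect_eq)

lemma dim_grad_phi [simp]: "u \<in> carrier_vec n \<Longrightarrow> dim_vec (grad_phi u) = n"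
  using grad_phi_carrier[of u] by (simp only: carrier_vec_def mem_Collect_eq)

lemma G_add: "u \<in> carrier_vec n \<Longrightarrow> v \<in> carrier_vec n \<Longrightarrow> G (u + v) = G u + G v"
  using Q A by (intro eq_vecI) (simp_all add: G_def mult_add_distrib_mat_vec[of _ _ n]
      mult_add_distrib_mat_vec[of _ _ m] algebra_simps)

lemma G_smult: "u \<in> carrier_vec n \<Longrightarrow> G (a \<cdot>\<^sub>v u) = a \<cdot>\<^sub>v G u"
  using Q A by (intro eq_vecI) (simp_all add: G_def mult_mat_vec[of _ _ n] mult_mat_vec[of _ _ m] algebra_simps)

lemma scalar_prod_G:
  assumes u: "u \<in> carrier_vec n"
  shows "u \<bullet> G u = u \<bullet> (Q *\<^sub>v u) + omega * (norm2 u)\<^sup>2 + (norm2 (A *\<^sub>v u))\<^sup>2 / omega"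
proof -
  have "(transpose_mat A *\<^sub>v (A *\<^sub>v u)) \<bullet> u = (A *\<^sub>v u) \<bullet> (A *\<^sub>v u)"
    using A u by (intro transpose_vec_mult_scalar) auto
  then have "u \<bullet> (transpose_mat A *\<^sub>v (A *\<^sub>v u)) = (norm2 (A *\<^sub>v u))\<^sup>2"
    using A u by (subst comm_scalar_prod[of _ n]) (auto simp: scalar_prod_self)
  then show ?thesis
    using Q A u by (simp add: G_def scalar_prod_add_distrib[of _ n] scalar_prod_self)
qed

lemma scalar_prod_G_ge: "u \<in> carrier_vec n \<Longrightarrow> omega * (norm2 u)\<^sup>2 \<le> u \<bullet> G u"
  using Q_psd[of u] omega_pos by (simp add: scalar_prod_G)

lemma phi_line:
  assumes x: "x \<in> carrier_vec n" and u: "u \<in> carrier_vec n"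
  shows "phi (x + t \<cdot>\<^sub>v u) = phi x + t * (u \<bullet> grad_phi x) + t\<^sup>2 / 2 * (u \<bullet> G u)"
proof -
  have Qsym: "x \<bullet> (Q *\<^sub>v u) = u \<bullet> (Q *\<^sub>v x)"
    using transpose_vec_mult_scalar[OF Q x u] Q_sym Q x u comm_scalar_prod[of "Q *\<^sub>v u" n x]
      comm_scalar_prod[of u n "Q *\<^sub>v x"] transpose_vec_mult_scalar[OF Q u x] by simp
  have quad: "quad_obj Q c (x + t \<cdot>\<^sub>v u) =
      quad_obj Q c x + t * (u \<bullet> (Q *\<^sub>v x) + u \<bullet> c) + t\<^sup>2 / 2 * (u \<bullet> (Q *\<^sub>v u))"
    using Q x u c Qsym comm_scalar_prod[OF c u]
    by (simp add: quad_obj_def mult_line[of _ n n] scalar_prod_add_distrib[of _ n]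
        add_scalar_prod_distrib[of _ n] mult_mat_vec[of _ n n] algebra_simps power2_eq_square)
  have "A *\<^sub>v (x + t \<cdot>\<^sub>v u) - b = (A *\<^sub>v x - b) + t \<cdot>\<^sub>v (A *\<^sub>v u)"
    using A x u b by (intro eq_vecI) (simp_all add: mult_line[of _ m n] algebra_simps)
  then have res: "(norm2 (A *\<^sub>v (x + t \<cdot>\<^sub>v u) - b))\<^sup>2 =
      (norm2 (A *\<^sub>v x - b))\<^sup>2 + 2 * t * ((A *\<^sub>v u) \<bullet> (A *\<^sub>v x - b)) + t\<^sup>2 * (norm2 (A *\<^sub>v u))\<^sup>2"
    using norm2_sq_line[of "A *\<^sub>v x - b" m "A *\<^sub>v u"] A x u b by simp
  have "u \<bullet> (transpose_mat A *\<^sub>v (A *\<^sub>v x - b)) = (transpose_mat A *\<^sub>v (A *\<^sub>v x - b)) \<bullet> u"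
    using A x u b by (intro comm_scalar_prod[of _ n]) auto
  also have "\<dots> = (A *\<^sub>v x - b) \<bullet> (A *\<^sub>v u)"
    using A x u b by (intro transpose_vec_mult_scalar) auto
  also have "\<dots> = (A *\<^sub>v u) \<bullet> (A *\<^sub>v x - b)"
    using A x u b by (intro comm_scalar_prod[of _ m]) auto
  finally have tr: "u \<bullet> (transpose_mat A *\<^sub>v (A *\<^sub>v x - b)) = (A *\<^sub>v u) \<bullet> (A *\<^sub>v x - b)" .
  have "u \<bullet> grad_phi x = u \<bullet> (Q *\<^sub>v x) + omega * (u \<bullet> x) + u \<bullet> c
      + 1 / omega * ((A *\<^sub>v u) \<bullet> (A *\<^sub>v x - b))"
    using Q A x u b c by (simp add: grad_phi_def scalar_prod_add_distrib[of _ n] tr)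
  then show ?thesis
    using omega_pos unfolding phi_def quad res norm2_sq_line[OF x u] scalar_prod_G[OF u]
    by (simp add: field_simps)
qed

lemma grad_phi_line:
  assumes x: "x \<in> carrier_vec n" and u: "u \<in> carrier_vec n"
  shows "grad_phi (x + t \<cdot>\<^sub>v u) = grad_phi x + t \<cdot>\<^sub>v G u"
proof -
  have "A *\<^sub>v (x + t \<cdot>\<^sub>v u) - b = (A *\<^sub>v x - b) + t \<cdot>\<^sub>v (A *\<^sub>v u)"
    using A x u b by (intro eq_vecI) (simp_all add: mult_line[of _ m n] algebra_simps)
  then show ?thesis
    using A Q x u b c
    by (intro eq_vecI) (simp_all add: grad_phi_def G_def mult_line[of _ n n] mult_line[of _ n m] algebra_simps)
qed

lemma f_eq: "f x = phi x / tau_A - (\<Sum>j<n. ln (1 + x $ j) + ln (1 - x $ j))"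
  by (simp add: f_def phi_def)

lemma gradient_f:
  assumes x: "x \<in> Omega n" and i: "i < n"
  shows "gradient f x $ i = grad_phi x $ i / tau_A - 1 / (1 + x $ i) + 1 / (1 - x $ i)"
proof -
  have xc: "x \<in> carrier_vec n" and xb: "\<And>j. j < n \<Longrightarrow> -1 < x $ j \<and> x $ j < 1"
    using x n_pos by (auto simp: Omega_iff)
  let ?e = "unit_vec n i"
  have ln_deriv: "((\<lambda>t. ln (1 + (x $ j + (if j = i then t else 0))) + ln (1 - (x $ j + (if j = i then t else 0))))
      has_real_derivative (if j = i then 1 else 0) / (1 + x $ j) + - (if j = i then 1 else 0) / (1 - x $ j)) (at 0)"
    if "j < n" for j
    using xb[OF that] by (cases "j = i") (auto intro!: derivative_eq_intros)
  have "((\<lambda>t. (phi x + t * (?e \<bullet> grad_phi x) + t\<^sup>2 / 2 * (?e \<bullet> G ?e)) / tau_A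
      - (\<Sum>j<n. ln (1 + (x $ j + (if j = i then t else 0))) + ln (1 - (x $ j + (if j = i then t else 0)))))
      has_real_derivative (?e \<bullet> grad_phi x) / tau_A - (\<Sum>j<n. (if j = i then 1 else 0) / (1 + x $ j)
        + - (if j = i then 1 else 0) / (1 - x $ j))) (at 0)"
    using ln_deriv tau_A_pos by (intro DERIV_diff DERIV_sum) (auto intro!: derivative_eq_intros)
  also have "(\<lambda>t. (phi x + t * (?e \<bullet> grad_phi x) + t\<^sup>2 / 2 * (?e \<bullet> G ?e)) / tau_A
      - (\<Sum>j<n. ln (1 + (x $ j + (if j = i then t else 0))) + ln (1 - (x $ j + (if j = i then t else 0)))))
      = (\<lambda>t. f (x + t \<cdot>\<^sub>v ?e))"
    using xc i by (simp add: f_eq phi_line if_distrib[of "(*) _"] cong: if_cong)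
  finally have "deriv (\<lambda>t. f (x + t \<cdot>\<^sub>v ?e)) 0 = (?e \<bullet> grad_phi x) / tau_A
      - (\<Sum>j<n. (if j = i then 1 else 0) / (1 + x $ j) + - (if j = i then 1 else 0) / (1 - x $ j))"
    by (rule DERIV_imp_deriv)
  also have "(\<Sum>j<n. (if j = i then 1 else 0) / (1 + x $ j) + - (if j = i then 1 else 0) / (1 - x $ j))
      = (\<Sum>j<n. if j = i then 1 / (1 + x $ i) - 1 / (1 - x $ i) else 0)"
    by (intro sum.cong) auto
  also have "\<dots> = 1 / (1 + x $ i) - 1 / (1 - x $ i)" using i by simp
  finally show ?thesis using xc i by (simp add: gradient_def)
qed

lemma eventually_Omega:
  assumes x: "x \<in> Omega n" and j: "j < n"
  shows "eventually (\<lambda>t. x + t \<cdot>\<^sub>v unit_vec n j \<in> Omega n) (nhds 0)"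
proof -
  have xc: "x \<in> carrier_vec n" and xb: "\<And>j. j < n \<Longrightarrow> -1 < x $ j \<and> x $ j < 1"
    using x n_pos by (auto simp: Omega_iff)
  have "eventually (\<lambda>t. -1 < x $ j + t \<and> x $ j + t < 1) (nhds 0)"
  proof -
    have "eventually (\<lambda>t. t \<in> {-1 - x $ j<..<1 - x $ j}) (nhds 0)"
      using xb[OF j] by (intro eventually_nhds_in_open) auto
    then show ?thesis by eventually_elim auto
  qed
  then show ?thesis
    by eventually_elim (use xc xb n_pos j in \<open>auto simp: Omega_iff\<close>)
qed

lemma hessian_f_entry:
  assumes x: "x \<in> Omega n" and i: "i < n" and j: "j < n"
  shows "hessian f x $$ (i, j) = G (unit_vec n j) $ i / tau_A
     + (1 / (1 + x $ i)\<^sup>2 + 1 / (1 - x $ i)\<^sup>2) * unit_vec n j $ i"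
proof -
  have xc: "x \<in> carrier_vec n" and xb: "\<And>j. j < n \<Longrightarrow> -1 < x $ j \<and> x $ j < 1"
    using x n_pos by (auto simp: Omega_iff)
  let ?e = "unit_vec n j" and ?d = "if i = j then 1 else (0::real)"
  let ?g = "\<lambda>t. (grad_phi x $ i + t * G ?e $ i) / tau_A
      - 1 / (1 + (x $ i + t * ?d)) + 1 / (1 - (x $ i + t * ?d))"
  have "(?g has_real_derivative G ?e $ i / tau_A + (1 / (1 + x $ i)\<^sup>2 + 1 / (1 - x $ i)\<^sup>2) * ?d) (at 0)"
  proof -
    have "((\<lambda>t. 1 / (1 + (x $ i + t * ?d))) has_real_derivative - ?d / (1 + x $ i)\<^sup>2) (at 0)"
      using xb[OF i] by (auto intro!: derivative_eq_intros simp: power2_eq_square)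
    moreover have "((\<lambda>t. 1 / (1 - (x $ i + t * ?d))) has_real_derivative ?d / (1 - x $ i)\<^sup>2) (at 0)"
      using xb[OF i] by (auto intro!: derivative_eq_intros simp: power2_eq_square)
    moreover have "((\<lambda>t. (grad_phi x $ i + t * G ?e $ i) / tau_A) has_real_derivative G ?e $ i / tau_A) (at 0)"
      using tau_A_pos by (auto intro!: derivative_eq_intros)
    ultimately have "(?g has_real_derivative G ?e $ i / tau_A - - ?d / (1 + x $ i)\<^sup>2 + ?d / (1 - x $ i)\<^sup>2) (at 0)"
      by (intro DERIV_add DERIV_diff)
    then show ?thesis by (simp add: algebra_simps)
  qed
  then have "deriv ?g 0 = G ?e $ i / tau_A + (1 / (1 + x $ i)\<^sup>2 + 1 / (1 - x $ i)\<^sup>2) * ?d"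
    by (rule DERIV_imp_deriv)
  moreover have "deriv (\<lambda>t. gradient f (x + t \<cdot>\<^sub>v ?e) $ i) 0 = deriv ?g 0"
  proof (rule deriv_cong_ev)
    show "\<forall>\<^sub>F t in nhds 0. gradient f (x + t \<cdot>\<^sub>v ?e) $ i = ?g t"
      using eventually_Omega[OF x j]
      by eventually_elim (use i j xc in \<open>auto simp: gradient_f grad_phi_line\<close>)
  qed simp
  ultimately show ?thesis
    using xc i j by (simp add: hessian_def jacobian_def gradient_def)
qed

lemma hessian_f_carrier: "x \<in> carrier_vec n \<Longrightarrow> hessian f x \<in> carrier_mat n n"
  by (auto simp: hessian_def jacobian_def gradient_def)

lemma hessian_f_mult:
  assumes x: "x \<in> Omega n" and i: "i < n" and d: "d \<in> carrier_vec n"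
  shows "(hessian f x *\<^sub>v d) $ i = G d $ i / tau_A + (1 / (1 + x $ i)\<^sup>2 + 1 / (1 - x $ i)\<^sup>2) * d $ i"
proof -
  have xc: "x \<in> carrier_vec n" using x by (simp add: Omega_def)
  let ?l = "\<lambda>d. G d $ i / tau_A + (1 / (1 + x $ i)\<^sup>2 + 1 / (1 - x $ i)\<^sup>2) * d $ i"
  have "?l d = (\<Sum>j<n. ?l (unit_vec n j) * d $ j)"
    using i d by (intro linear_map_sum[where l = ?l])
      (auto simp: G_add G_smult add_divide_distrib algebra_simps)
  also have "\<dots> = (\<Sum>j<n. hessian f x $$ (i, j) * d $ j)"
    using hessian_f_entry[OF x i] by simp
  also have "\<dots> = (hessian f x *\<^sub>v d) $ i"
    using hessian_f_carrier[OF xc] i d by (simp add: scalar_prod_sum[of _ n])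
  finally show ?thesis by simp
qed

section \<open>The centering phase\<close>

text \<open>
  The squared norm of \<open>d\<close> induced by the Hessian of the barrier at \<open>x\<close>.
\<close>

definition local_sq :: "real vec \<Rightarrow> real vec \<Rightarrow> real" where
  "local_sq x d = (\<Sum>i<n. (d $ i / (1 + x $ i))\<^sup>2 + (d $ i / (1 - x $ i))\<^sup>2)"

text \<open>
  The invariant of the centering phase: the Newton step of \<open>f\<close> at \<open>x\<close> is short. Quantifying over all solutions
  of the Newton system avoids speaking about the inverse of the Hessian.
\<close>

definition centered :: "real vec \<Rightarrow> bool" where
  "centered x \<longleftrightarrow> x \<in> Omega n \<and>
     (\<forall>d\<in>carrier_vec n. hessian f x *\<^sub>v d = gradient f x \<longrightarrow> local_sq x d \<le> 1 / 32)"

lemma gradient_f_carrier [simp]: "x \<in> carrier_vec n \<Longrightarrow> gradient f x \<in> carrier_vec n"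
  by (auto simp: gradient_def)

lemma Omega_carrier: "x \<in> Omega n \<Longrightarrow> x \<in> carrier_vec n"
  by (simp add: Omega_def)

lemma Omega_bounds: "x \<in> Omega n \<Longrightarrow> i < n \<Longrightarrow> 0 < 1 + x $ i \<and> 0 < 1 - x $ i"
  using n_pos by (auto simp: Omega_iff)

lemma scalar_prod_hessian:
  assumes x: "x \<in> Omega n" and d: "d \<in> carrier_vec n"
  shows "d \<bullet> (hessian f x *\<^sub>v d) = (d \<bullet> G d) / tau_A + local_sq x d"
proof -
  have "d \<bullet> (hessian f x *\<^sub>v d) = (\<Sum>i<n. d $ i * (hessian f x *\<^sub>v d) $ i)"
    using hessian_f_carrier[OF Omega_carrier[OF x]] d by (intro scalar_prod_sum) auto
  also have "\<dots> = (\<Sum>i<n. d $ i * G d $ i / tau_A + ((d $ i / (1 + x $ i))\<^sup>2 + (d $ i / (1 - x $ i))\<^sup>2))"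
    by (intro sum.cong refl) (simp add: hessian_f_mult[OF x _ d] power_divide algebra_simps power2_eq_square)
  also have "\<dots> = (d \<bullet> G d) / tau_A + local_sq x d"
    using d by (simp add: sum.distrib local_sq_def scalar_prod_sum[of _ n] sum_divide_distrib)
  finally show ?thesis .
qed

lemma scalar_prod_G_nonneg: "d \<in> carrier_vec n \<Longrightarrow> 0 \<le> d \<bullet> G d"
  using scalar_prod_G_ge[of d] omega_pos by (smt (verit) mult_nonneg_nonneg zero_le_power2)

lemma local_sq_nonneg: "0 \<le> local_sq x d"
  by (simp add: local_sq_def sum_nonneg)

lemma hessian_f_kernel:
  assumes x: "x \<in> Omega n" and v: "v \<in> carrier_vec n" and eq: "hessian f x *\<^sub>v v = 0\<^sub>v n"
  shows "v = 0\<^sub>v n"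
proof -
  have "0 = (v \<bullet> G v) / tau_A + local_sq x v"
    using scalar_prod_hessian[OF x v] v by (simp add: eq)
  moreover have "0 \<le> (v \<bullet> G v) / tau_A" using scalar_prod_G_nonneg[OF v] tau_A_pos by simp
  ultimately have "(v \<bullet> G v) / tau_A = 0" using local_sq_nonneg[of x v] by linarith
  then have "omega * (norm2 v)\<^sup>2 \<le> 0" using tau_A_pos scalar_prod_G_ge[OF v] by simp
  then have "norm2 v = 0" using omega_pos by (simp add: mult_le_0_iff)
  then show ?thesis using v by (rule norm2_eq_0D)
qed

lemma newton_local_sq_le:
  assumes x: "x \<in> Omega n" and d: "d \<in> carrier_vec n" and eq: "hessian f x *\<^sub>v d = gradient f x"
  shows "local_sq x d \<le> d \<bullet> gradient f x"
  using scalar_prod_hessian[OF x d] scalar_prod_G_nonneg[OF d] tau_A_pos by (simp add: eq)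

lemma local_sq_component_le:
  assumes "i < n"
  shows "(d $ i / (1 + x $ i))\<^sup>2 + (d $ i / (1 - x $ i))\<^sup>2 \<le> local_sq x d"
  unfolding local_sq_def using assms
  by (intro member_le_sum[of i "{..<n}" "\<lambda>i. (d $ i / (1 + x $ i))\<^sup>2 + (d $ i / (1 - x $ i))\<^sup>2"]) auto

lemma local_ball_Omega:
  assumes x: "x \<in> Omega n" and d: "d \<in> carrier_vec n" and small: "local_sq x d < 1"
  shows "x - d \<in> Omega n"
proof -
  have "-1 < (x - d) $ i \<and> (x - d) $ i < 1" if i: "i < n" for i
  proof -
    have "(d $ i / (1 + x $ i))\<^sup>2 < 1" "(d $ i / (1 - x $ i))\<^sup>2 < 1"
      using local_sq_component_le[OF i, of d x] small
        zero_le_power2[of "d $ i / (1 + x $ i)"] zero_le_power2[of "d $ i / (1 - x $ i)"] by linarith+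
    then have "\<bar>d $ i / (1 + x $ i)\<bar> < 1" "\<bar>d $ i / (1 - x $ i)\<bar> < 1"
      by (simp_all only: abs_square_less_1)
    then have "\<bar>d $ i\<bar> < 1 + x $ i" "\<bar>d $ i\<bar> < 1 - x $ i"
      using Omega_bounds[OF x i] by (simp_all add: abs_divide)
    then show ?thesis using d i by auto
  qed
  then show ?thesis using d Omega_carrier[OF x] n_pos by (auto simp: Omega_iff)
qed

lemma centered_newton_step:
  assumes cx: "centered x" and d: "d \<in> carrier_vec n" and eq: "hessian f x *\<^sub>v d = gradient f x"
  shows "centered (x - d)"
proof -
  have x: "x \<in> Omega n" and small: "local_sq x d \<le> 1 / 32" using cx d eq by (auto simp: centered_def)
  have xc: "x \<in> carrier_vec n" using x by (rule Omega_carrier)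
  have y: "x - d \<in> Omega n" using x d small by (intro local_ball_Omega) auto
  have grad: "gradient f (x - d) $ i =
     (d $ i / (1 - x $ i))\<^sup>2 / (1 - (x - d) $ i) - (d $ i / (1 + x $ i))\<^sup>2 / (1 + (x - d) $ i)" if i: "i < n" for i
  proof -
    have "x - d = x + (-1) \<cdot>\<^sub>v d" using xc d by auto
    then have lin: "grad_phi (x - d) $ i = grad_phi x $ i - G d $ i"
      using grad_phi_line[OF xc d, of "-1"] xc d i by simp
    have newton: "G d $ i / tau_A + (1 / (1 + x $ i)\<^sup>2 + 1 / (1 - x $ i)\<^sup>2) * d $ i
        = grad_phi x $ i / tau_A - 1 / (1 + x $ i) + 1 / (1 - x $ i)"
      using arg_cong[OF eq, of "\<lambda>v. v $ i"] by (simp add: hessian_f_mult[OF x i d] gradient_f[OF x i])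
    have pos: "0 < 1 + x $ i" "0 < 1 - x $ i" "0 < 1 + x $ i - d $ i" "0 < 1 - x $ i - - d $ i"
      using Omega_bounds[OF x i] Omega_bounds[OF y i] d i by auto
    show ?thesis
      using newton inverse_remainder[OF pos(1,3)] inverse_remainder[OF pos(2,4)] d i
      by (simp add: gradient_f[OF y i] lin diff_divide_distrib algebra_simps)
  qed
  have "local_sq (x - d) e \<le> 1 / 32"
    if e: "e \<in> carrier_vec n" and eq': "hessian f (x - d) *\<^sub>v e = gradient f (x - d)" for e
  proof -
    have amgm: "p * t \<le> (p\<^sup>2 + t) / 2" if "0 \<le> t" "t \<le> 1" for p t :: real
    proof -
      have "0 \<le> (p - t)\<^sup>2" by simp
      moreover have "t * t \<le> t" using that by (simp add: mult_left_le)
      ultimately show ?thesis by (simp add: power2_eq_square algebra_simps)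
    qed
    have "local_sq (x - d) e \<le> e \<bullet> gradient f (x - d)" by (rule newton_local_sq_le[OF y e eq'])
    also have "\<dots> = (\<Sum>i<n. e $ i * gradient f (x - d) $ i)"
      using xc d by (intro scalar_prod_sum) simp
    also have "\<dots> \<le> (\<Sum>i<n. ((e $ i / (1 + (x - d) $ i))\<^sup>2 + (e $ i / (1 - (x - d) $ i))\<^sup>2
        + ((d $ i / (1 + x $ i))\<^sup>2 + (d $ i / (1 - x $ i))\<^sup>2)) / 2)"
    proof (intro sum_mono)
      fix i
      assume "i \<in> {..<n}"
      then have i: "i < n" by simp
      define s where "s = (d $ i / (1 + x $ i))\<^sup>2"
      define t where "t = (d $ i / (1 - x $ i))\<^sup>2"
      have st: "0 \<le> s" "0 \<le> t" "s \<le> 1" "t \<le> 1"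
        using local_sq_component_le[OF i, of d x] small
          zero_le_power2[of "d $ i / (1 + x $ i)"] zero_le_power2[of "d $ i / (1 - x $ i)"]
        unfolding s_def t_def by linarith+
      have "e $ i * gradient f (x - d) $ i =
         - (e $ i / (1 + (x - d) $ i)) * s + e $ i / (1 - (x - d) $ i) * t"
        unfolding grad[OF i] s_def t_def by (simp add: algebra_simps)
      also have "\<dots> \<le> ((- (e $ i / (1 + (x - d) $ i)))\<^sup>2 + s) / 2 + ((e $ i / (1 - (x - d) $ i))\<^sup>2 + t) / 2"
        using st by (intro add_mono amgm) auto
      finally show "e $ i * gradient f (x - d) $ i \<le> ((e $ i / (1 + (x - d) $ i))\<^sup>2 + (e $ i / (1 - (x - d) $ i))\<^sup>2
        + ((d $ i / (1 + x $ i))\<^sup>2 + (d $ i / (1 - x $ i))\<^sup>2)) / 2"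
        by (simp add: s_def t_def add_divide_distrib)
    qed
    \<comment> \<open>The half of the local norm of \<open>e\<close> that appears here is absorbed into the left-hand side.\<close>
    also have "\<dots> = (local_sq (x - d) e + local_sq x d) / 2"
      by (simp add: local_sq_def sum.distrib sum_divide_distrib[symmetric])
    finally show ?thesis using small by simp
  qed
  with y show ?thesis by (auto simp: centered_def)
qed

lemma centered_0: "centered (0\<^sub>v n)"
proof -
  have z: "0\<^sub>v n \<in> Omega n" using n_pos by (auto simp: Omega_iff)
  have g0: "grad_phi (0\<^sub>v n) = c - (1 / omega) \<cdot>\<^sub>v (transpose_mat A *\<^sub>v b)"
  proof -
    have "Q *\<^sub>v 0\<^sub>v n = 0\<^sub>v n" "A *\<^sub>v 0\<^sub>v n = 0\<^sub>v m" using Q A by auto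
    moreover have "0\<^sub>v m - b = (-1) \<cdot>\<^sub>v b" using b by auto
    ultimately show ?thesis
      using A b c by (intro eq_vecI) (simp_all add: grad_phi_def mult_mat_vec[of _ n m])
  qed
  have "gradient f (0\<^sub>v n) = (1 / tau_A) \<cdot>\<^sub>v grad_phi (0\<^sub>v n)"
    by (intro eq_vecI) (simp_all add: gradient_f[OF z] carrier_vecD[OF gradient_f_carrier[OF zero_carrier_vec]])
  then have norm: "norm2 (gradient f (0\<^sub>v n)) = norm2 (grad_phi (0\<^sub>v n)) / tau_A"
    using tau_A_pos by (simp add: norm2_smult)
  have "4 * norm2 (grad_phi (0\<^sub>v n)) \<le> tau_A" unfolding g0 tau_A_def by simp
  then have g: "norm2 (gradient f (0\<^sub>v n)) \<le> 1 / 4" unfolding norm using tau_A_pos by (simp add: field_simps)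
  have "local_sq (0\<^sub>v n) d \<le> 1 / 32"
    if d: "d \<in> carrier_vec n" and eq: "hessian f (0\<^sub>v n) *\<^sub>v d = gradient f (0\<^sub>v n)" for d
  proof -
    have sq: "local_sq (0\<^sub>v n) d = 2 * (norm2 d)\<^sup>2"
      using d by (simp add: local_sq_def norm2_sq sum_distrib_left)
    have "local_sq (0\<^sub>v n) d \<le> norm2 d * norm2 (gradient f (0\<^sub>v n))"
      using newton_local_sq_le[OF z d eq] scalar_prod_le_norm2[of d n "gradient f (0\<^sub>v n)"] d by simp
    also have "\<dots> \<le> norm2 d * (1 / 4)" using g by (intro mult_left_mono) auto
    finally have "2 * (norm2 d * norm2 d) \<le> norm2 d * (1 / 4)" by (simp add: sq power2_eq_square)
    then have "norm2 d \<le> 1 / 8"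
      by (cases "norm2 d = 0") (use norm2_nonneg[of d] in \<open>auto simp: less_le\<close>)
    then have "(norm2 d)\<^sup>2 \<le> (1 / 8)\<^sup>2" by (intro power_mono) auto
    then show ?thesis by (simp add: sq power2_eq_square)
  qed
  with z show ?thesis by (auto simp: centered_def)
qed

lemma centering_Some:
  "\<exists>x ds. centering k = Some (x, ds) \<and> centered x \<and> length ds = k \<and> (\<forall>d\<in>set ds. d \<le> N)"
proof (induction k)
  case 0
  show ?case by (simp add: centered_0)
next
  case (Suc k)
  then obtain x ds where x: "centering k = Some (x, ds)" "centered x" "length ds = k" "\<forall>d\<in>set ds. d \<le> N"
    by auto
  have xO: "x \<in> Omega n" using x(2) by (simp add: centered_def)
  obtain d where d: "solve (hessian f x) (gradient f x) ds = Some (d, n # ds)" "d \<in> carrier_vec n"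
      "hessian f x *\<^sub>v d = gradient f x"
    using solve_eq_Some[of "hessian f x" n "gradient f x"] hessian_f_kernel[OF xO]
      hessian_f_carrier Omega_carrier[OF xO] by (metis gradient_f_carrier)
  then show ?case
    using x xO centered_newton_step[OF x(2) d(2,3)] by (simp add: N_def)
qed

section \<open>The primal-dual system and its Jacobian\<close>

text \<open>
  The four blocks \<open>x\<close>, \<open>\<lambda>\<close>, \<open>\<mu>\<^sub>L\<close>, \<open>\<mu>\<^sub>R\<close> of a vector of dimension \<open>N\<close>. The same partition applies to the values of
  \<open>F\<close>, whose four components have the dimensions \<open>n\<close>, \<open>m\<close>, \<open>n\<close>, \<open>n\<close>.
\<close>

definition X :: "real vec \<Rightarrow> real vec" where "X z = vec_block 0 n z"
definition Lam :: "real vec \<Rightarrow> real vec" where "Lam z = vec_block n m z"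
definition MuL :: "real vec \<Rightarrow> real vec" where "MuL z = vec_block (n + m) n z"
definition MuR :: "real vec \<Rightarrow> real vec" where "MuR z = vec_block (n + m + n) n z"

text \<open>
  The vector with the given blocks.
\<close>

definition join :: "real vec \<Rightarrow> real vec \<Rightarrow> real vec \<Rightarrow> real vec \<Rightarrow> real vec" where
  "join u l p q = u @\<^sub>v l @\<^sub>v p @\<^sub>v q"

lemmas block_defs = X_def Lam_def MuL_def MuR_def vec_block_def

lemma block_carrier [simp]:
  "X z \<in> carrier_vec n" "Lam z \<in> carrier_vec m" "MuL z \<in> carrier_vec n" "MuR z \<in> carrier_vec n"
  by (simp_all add: block_defs)

lemma block_dim [simp]:
  "dim_vec (X z) = n" "dim_vec (Lam z) = m" "dim_vec (MuL z) = n" "dim_vec (MuR z) = n"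
  by (simp_all add: block_defs)

lemma join_carrier [simp]:
  assumes "u \<in> carrier_vec n" "l \<in> carrier_vec m" "p \<in> carrier_vec n" "q \<in> carrier_vec n"
  shows "join u l p q \<in> carrier_vec N"
proof -
  have N: "N = n + (m + (n + n))" by (simp add: N_def)
  show ?thesis unfolding join_def N using assms by (intro append_carrier_vec)
qed

lemma block_join [simp]:
  assumes "u \<in> carrier_vec n" "l \<in> carrier_vec m" "p \<in> carrier_vec n" "q \<in> carrier_vec n"
  shows "X (join u l p q) = u" "Lam (join u l p q) = l" "MuL (join u l p q) = p" "MuR (join u l p q) = q"
  using assms by (auto simp: join_def block_defs)

lemma block_eqI:
  assumes "u \<in> carrier_vec N" "v \<in> carrier_vec N"
    and "X u = X v" "Lam u = Lam v" "MuL u = MuL v" "MuR u = MuR v"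
  shows "u = v"
proof (rule eq_vecI)
  fix i
  assume "i < dim_vec v"
  then have i: "i < 3 * n + m" using assms(2) by (simp add: N_def)
  have idx: "vec_block off k u $ j = vec_block off k v $ j \<Longrightarrow> j < k \<Longrightarrow> u $ (off + j) = v $ (off + j)" for off k j
    by (simp add: vec_block_def)
  consider "i < n" | "n \<le> i" "i - n < m" | "n + m \<le> i" "i - (n + m) < n" | "n + m + n \<le> i" "i - (n + m + n) < n"
    using i by linarith
  then show "u $ i = v $ i"
  proof cases
    case 1
    then show ?thesis using idx[of 0 n i] assms(3) by (simp add: X_def)
  next
    case 2
    then show ?thesis using idx[of n m "i - n"] assms(4) by (simp add: Lam_def)
  next
    case 3
    then show ?thesis using idx[of "n + m" n "i - (n + m)"] assms(5) by (simp add: MuL_def)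
  next
    case 4
    then show ?thesis using idx[of "n + m + n" n "i - (n + m + n)"] assms(6) by (simp add: MuR_def)
  qed
qed (use assms in auto)

lemma block_linear [simp]:
  assumes "u \<in> carrier_vec N" "v \<in> carrier_vec N"
  shows "X (u + v) = X u + X v" "Lam (u + v) = Lam u + Lam v" "MuL (u + v) = MuL u + MuL v"
    "MuR (u + v) = MuR u + MuR v"
    "X (u - v) = X u - X v" "Lam (u - v) = Lam u - Lam v" "MuL (u - v) = MuL u - MuL v"
    "MuR (u - v) = MuR u - MuR v"
  using assms by (auto simp: block_defs N_def intro!: eq_vecI)

lemma block_smult [simp]:
  assumes "u \<in> carrier_vec N"
  shows "X (a \<cdot>\<^sub>v u) = a \<cdot>\<^sub>v X u" "Lam (a \<cdot>\<^sub>v u) = a \<cdot>\<^sub>v Lam u" "MuL (a \<cdot>\<^sub>v u) = a \<cdot>\<^sub>v MuL u"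
    "MuR (a \<cdot>\<^sub>v u) = a \<cdot>\<^sub>v MuR u"
  using assms by (auto simp: block_defs N_def intro!: eq_vecI)

lemma block_zero [simp]:
  "X (0\<^sub>v N) = 0\<^sub>v n" "Lam (0\<^sub>v N) = 0\<^sub>v m" "MuL (0\<^sub>v N) = 0\<^sub>v n" "MuR (0\<^sub>v N) = 0\<^sub>v n"
  by (auto simp: block_defs N_def intro!: eq_vecI)

text \<open>
  The two affine components of \<open>F\<close>, which do not depend on \<open>\<tau>\<close>.
\<close>

definition F1 :: "real vec \<Rightarrow> real vec" where
  "F1 z = Q *\<^sub>v X z + omega \<cdot>\<^sub>v X z + c - transpose_mat A *\<^sub>v Lam z - MuL z + MuR z"

definition F2 :: "real vec \<Rightarrow> real vec" where
  "F2 z = A *\<^sub>v X z - b + omega \<cdot>\<^sub>v Lam z"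

lemma F12_carrier [simp]: "F1 z \<in> carrier_vec n" "F2 z \<in> carrier_vec m"
  using Q A b c by (auto simp: F1_def F2_def)

lemma F_join: "F \<tau> z = join (F1 z) (F2 z)
    (vec n (\<lambda>i. MuL z $ i * (1 + X z $ i) - \<tau>)) (vec n (\<lambda>i. MuR z $ i * (1 - X z $ i) - \<tau>))"
  unfolding F_def join_def Let_def F1_def F2_def X_def[symmetric] Lam_def[symmetric] MuL_def[symmetric]
    MuR_def[symmetric]
  by (intro arg_cong2[of _ _ _ _ "(@\<^sub>v)"] refl eq_vecI) (auto simp: times_cw_def ones_vec_def)

lemma F_carrier [simp]: "F \<tau> z \<in> carrier_vec N"
  by (simp add: F_join)

lemma F_block [simp]:
  "X (F \<tau> z) = F1 z" "Lam (F \<tau> z) = F2 z"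
  "MuL (F \<tau> z) = vec n (\<lambda>i. MuL z $ i * (1 + X z $ i) - \<tau>)"
  "MuR (F \<tau> z) = vec n (\<lambda>i. MuR z $ i * (1 - X z $ i) - \<tau>)"
  by (simp_all add: F_join)

text \<open>
  The linear parts of \<^term>\<open>F1\<close> and \<^term>\<open>F2\<close>.
\<close>

definition dF1 :: "real vec \<Rightarrow> real vec" where
  "dF1 d = Q *\<^sub>v X d + omega \<cdot>\<^sub>v X d - transpose_mat A *\<^sub>v Lam d - MuL d + MuR d"

definition dF2 :: "real vec \<Rightarrow> real vec" where
  "dF2 d = A *\<^sub>v X d + omega \<cdot>\<^sub>v Lam d"

text \<open>
  The derivative of \<open>F\<close> at \<open>z\<close> in direction \<open>d\<close>; \<open>DF_mult\<close> below identifies it with the action of the matrix \<open>DF z\<close>.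
\<close>

definition dF :: "real vec \<Rightarrow> real vec \<Rightarrow> real vec" where
  "dF z d = join (dF1 d) (dF2 d)
    (vec n (\<lambda>i. MuL z $ i * X d $ i + (1 + X z $ i) * MuL d $ i))
    (vec n (\<lambda>i. - (MuR z $ i * X d $ i) + (1 - X z $ i) * MuR d $ i))"

lemma dF12_carrier [simp]: "dF1 z \<in> carrier_vec n" "dF2 z \<in> carrier_vec m"
  using Q A b by (auto simp: dF1_def dF2_def)

lemma dF_carrier [simp]: "dF z d \<in> carrier_vec N"
  by (simp add: dF_def)

lemma dim_dF [simp]: "dim_vec (dF z d) = N"
  using dF_carrier[of z d] by (simp only: carrier_vec_def mem_Collect_eq)

lemma dF_block [simp]:
  "X (dF z d) = dF1 d" "Lam (dF z d) = dF2 d"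
  "MuL (dF z d) = vec n (\<lambda>i. MuL z $ i * X d $ i + (1 + X z $ i) * MuL d $ i)"
  "MuR (dF z d) = vec n (\<lambda>i. - (MuR z $ i * X d $ i) + (1 - X z $ i) * MuR d $ i)"
  by (simp_all add: dF_def)

lemma F1_line:
  assumes "z \<in> carrier_vec N" "d \<in> carrier_vec N"
  shows "F1 (z + t \<cdot>\<^sub>v d) = F1 z + t \<cdot>\<^sub>v dF1 d" "F2 (z + t \<cdot>\<^sub>v d) = F2 z + t \<cdot>\<^sub>v dF2 d"
  using assms Q A b c
  by (simp_all add: F1_def F2_def dF1_def dF2_def mult_line[of _ n n] mult_line[of _ n m] mult_line[of _ m n])
    (intro eq_vecI; simp add: algebra_simps)+

text \<open>
  As \<open>F\<close> is quadratic, its expansion along a line is exact.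
\<close>

lemma F_line:
  assumes "z \<in> carrier_vec N" "d \<in> carrier_vec N"
  shows "F \<tau> (z + t \<cdot>\<^sub>v d) = F \<tau> z + t \<cdot>\<^sub>v dF z d
     + t\<^sup>2 \<cdot>\<^sub>v join (0\<^sub>v n) (0\<^sub>v m) (vec n (\<lambda>i. MuL d $ i * X d $ i)) (vec n (\<lambda>i. - (MuR d $ i * X d $ i)))"
proof (rule block_eqI)
  show "MuL (F \<tau> (z + t \<cdot>\<^sub>v d)) = MuL (F \<tau> z + t \<cdot>\<^sub>v dF z d
     + t\<^sup>2 \<cdot>\<^sub>v join (0\<^sub>v n) (0\<^sub>v m) (vec n (\<lambda>i. MuL d $ i * X d $ i)) (vec n (\<lambda>i. - (MuR d $ i * X d $ i))))"
    using assms by (simp, intro eq_vecI) (simp_all add: field_simps power2_eq_square)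
  show "MuR (F \<tau> (z + t \<cdot>\<^sub>v d)) = MuR (F \<tau> z + t \<cdot>\<^sub>v dF z d
     + t\<^sup>2 \<cdot>\<^sub>v join (0\<^sub>v n) (0\<^sub>v m) (vec n (\<lambda>i. MuL d $ i * X d $ i)) (vec n (\<lambda>i. - (MuR d $ i * X d $ i))))"
    using assms by (simp, intro eq_vecI) (simp_all add: field_simps power2_eq_square)
qed (use assms in \<open>simp_all add: F1_line, (intro eq_vecI; simp)+\<close>)

lemma dF12_add:
  assumes "u \<in> carrier_vec N" "v \<in> carrier_vec N"
  shows "dF1 (u + v) = dF1 u + dF1 v" "dF2 (u + v) = dF2 u + dF2 v"
  using assms Q A
  by (simp_all add: dF1_def dF2_def mult_add_distrib_mat_vec[of _ n n]
      mult_add_distrib_mat_vec[of _ n m] mult_add_distrib_mat_vec[of _ m n])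
    (intro eq_vecI; simp add: algebra_simps)+

lemma dF12_smult:
  assumes "u \<in> carrier_vec N"
  shows "dF1 (a \<cdot>\<^sub>v u) = a \<cdot>\<^sub>v dF1 u" "dF2 (a \<cdot>\<^sub>v u) = a \<cdot>\<^sub>v dF2 u"
  using assms Q A
  by (simp_all add: dF1_def dF2_def mult_mat_vec[of _ n n] mult_mat_vec[of _ n m] mult_mat_vec[of _ m n])
    (intro eq_vecI; simp add: algebra_simps)+

lemma dF_add:
  assumes "u \<in> carrier_vec N" "v \<in> carrier_vec N"
  shows "dF z (u + v) = dF z u + dF z v"
proof (rule block_eqI)
  show "MuL (dF z (u + v)) = MuL (dF z u + dF z v)"
    using assms by (simp, intro eq_vecI) (simp_all add: field_simps)
  show "MuR (dF z (u + v)) = MuR (dF z u + dF z v)"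
    using assms by (simp, intro eq_vecI) (simp_all add: field_simps)
qed (use assms in \<open>simp_all add: dF12_add\<close>)

lemma dF_smult:
  assumes "u \<in> carrier_vec N"
  shows "dF z (a \<cdot>\<^sub>v u) = a \<cdot>\<^sub>v dF z u"
proof (rule block_eqI)
  show "MuL (dF z (a \<cdot>\<^sub>v u)) = MuL (a \<cdot>\<^sub>v dF z u)"
    using assms by (simp, intro eq_vecI) (simp_all add: field_simps)
  show "MuR (dF z (a \<cdot>\<^sub>v u)) = MuR (a \<cdot>\<^sub>v dF z u)"
    using assms by (simp, intro eq_vecI) (simp_all add: field_simps)
qed (use assms in \<open>simp_all add: dF12_smult\<close>)

lemma DF_carrier: "z \<in> carrier_vec N \<Longrightarrow> DF z \<in> carrier_mat N N"
  by (auto simp: DF_def jacobian_def carrier_vecD[OF F_carrier])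

lemma DF_entry:
  assumes z: "z \<in> carrier_vec N" and i: "i < N" and j: "j < N"
  shows "DF z $$ (i, j) = dF z (unit_vec N j) $ i"
proof -
  let ?q = "join (0\<^sub>v n) (0\<^sub>v m) (vec n (\<lambda>i. MuL (unit_vec N j) $ i * X (unit_vec N j) $ i))
     (vec n (\<lambda>i. - (MuR (unit_vec N j) $ i * X (unit_vec N j) $ i))) $ i"
  have "((\<lambda>t. F 0 z $ i + t * dF z (unit_vec N j) $ i + t\<^sup>2 * ?q)
      has_real_derivative dF z (unit_vec N j) $ i) (at 0)"
    by (auto intro!: derivative_eq_intros)
  then have "deriv (\<lambda>t. F 0 z $ i + t * dF z (unit_vec N j) $ i + t\<^sup>2 * ?q) 0 = dF z (unit_vec N j) $ i"
    by (rule DERIV_imp_deriv)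
  moreover have "F 0 (z + t \<cdot>\<^sub>v unit_vec N j) $ i = F 0 z $ i + t * dF z (unit_vec N j) $ i + t\<^sup>2 * ?q" for t
    using z i by (simp add: F_line carrier_vecD[OF join_carrier])
  ultimately show ?thesis
    using z i j by (simp add: DF_def jacobian_def carrier_vecD[OF F_carrier])
qed

lemma DF_mult:
  assumes z: "z \<in> carrier_vec N" and d: "d \<in> carrier_vec N"
  shows "DF z *\<^sub>v d = dF z d"
proof (rule eq_vecI)
  fix i
  assume "i < dim_vec (dF z d)"
  then have i: "i < N" using dF_carrier[of z d] by simp
  have "dF z d $ i = (\<Sum>j<N. dF z (unit_vec N j) $ i * d $ j)"
    using i d by (intro linear_map_sum[where l = "\<lambda>d. dF z d $ i"])
      (auto simp: dF_add dF_smult)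
  also have "\<dots> = (DF z *\<^sub>v d) $ i"
    using DF_carrier[OF z] i d by (simp add: scalar_prod_sum[of _ N] DF_entry[OF z])
  finally show "(DF z *\<^sub>v d) $ i = dF z d $ i" by simp
qed (use DF_carrier[OF z] in auto)

text \<open>
  If moreover \<^prop>\<open>dF1 d = 0\<^sub>v n\<close>, the right-hand side is nonnegative. This monotonicity is what
  \<open>newton_products\<close> requires, and the strict version gives the nonsingularity of the Jacobian.
\<close>

lemma energy_identity:
  assumes d: "d \<in> carrier_vec N" and lam: "dF2 d = 0\<^sub>v m"
  shows "(\<Sum>i<n. X d $ i * (MuL d $ i - MuR d $ i)) =
     X d \<bullet> (Q *\<^sub>v X d) + omega * (norm2 (X d))\<^sup>2 + omega * (norm2 (Lam d))\<^sup>2 - X d \<bullet> dF1 d"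
proof -
  have "A *\<^sub>v X d = (- omega) \<cdot>\<^sub>v Lam d"
  proof (rule eq_vecI)
    fix i
    assume "i < dim_vec (- omega \<cdot>\<^sub>v Lam d)"
    then have i: "i < m" by simp
    then show "(A *\<^sub>v X d) $ i = (- omega \<cdot>\<^sub>v Lam d) $ i"
      using arg_cong[OF lam, of "\<lambda>v. v $ i"] A by (simp add: dF2_def)
  qed (use A in simp)
  then have "Lam d \<bullet> (A *\<^sub>v X d) = - omega * (norm2 (Lam d))\<^sup>2"
    by (simp add: scalar_prod_self)
  moreover have "X d \<bullet> (transpose_mat A *\<^sub>v Lam d) = Lam d \<bullet> (A *\<^sub>v X d)"
    using transpose_vec_mult_scalar[OF A block_carrier(1) block_carrier(2), of d d] A
    by (subst comm_scalar_prod[of _ n]) auto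
  moreover have "X d \<bullet> dF1 d = X d \<bullet> (Q *\<^sub>v X d) + omega * (norm2 (X d))\<^sup>2
      - X d \<bullet> (transpose_mat A *\<^sub>v Lam d) - X d \<bullet> MuL d + X d \<bullet> MuR d"
    using Q A by (simp add: dF1_def scalar_prod_add_distrib[of _ n] scalar_prod_minus_distrib[of _ n] scalar_prod_self)
  moreover have "(\<Sum>i<n. X d $ i * (MuL d $ i - MuR d $ i)) = X d \<bullet> MuL d - X d \<bullet> MuR d"
    by (simp add: scalar_prod_sum[of _ n] right_diff_distrib sum_subtractf)
  ultimately show ?thesis by simp
qed

text \<open>
  Positivity of all slacks and multipliers; that \<open>X z \<in> Omega n\<close> expresses the positivity of \<open>1 + x\<close> and \<open>1 - x\<close>.
\<close>

definition interior_point :: "real vec \<Rightarrow> bool" where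
  "interior_point z \<longleftrightarrow> z \<in> carrier_vec N \<and> X z \<in> Omega n \<and>
     (\<forall>i<n. 0 < MuL z $ i) \<and> (\<forall>i<n. 0 < MuR z $ i)"

lemma DF_kernel:
  assumes z: "interior_point z" and d: "d \<in> carrier_vec N" and eq: "DF z *\<^sub>v d = 0\<^sub>v N"
  shows "d = 0\<^sub>v N"
proof -
  have zc: "z \<in> carrier_vec N" using z by (simp add: interior_point_def)
  have dz: "dF z d = 0\<^sub>v N" using DF_mult[OF zc d] eq by simp
  have "X (dF z d) = 0\<^sub>v n" "Lam (dF z d) = 0\<^sub>v m" "MuL (dF z d) = 0\<^sub>v n" "MuR (dF z d) = 0\<^sub>v n"
    unfolding dz by simp_all
  then have eqs: "dF1 d = 0\<^sub>v n" "dF2 d = 0\<^sub>v m"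
    "vec n (\<lambda>i. MuL z $ i * X d $ i + (1 + X z $ i) * MuL d $ i) = 0\<^sub>v n"
    "vec n (\<lambda>i. - (MuR z $ i * X d $ i) + (1 - X z $ i) * MuR d $ i) = 0\<^sub>v n"
    unfolding dF_block by simp_all
  have eqL: "MuL z $ i * X d $ i + (1 + X z $ i) * MuL d $ i = 0"
    and eqR: "- (MuR z $ i * X d $ i) + (1 - X z $ i) * MuR d $ i = 0" if "i < n" for i
    using arg_cong[OF eqs(3), of "\<lambda>v. v $ i"] arg_cong[OF eqs(4), of "\<lambda>v. v $ i"] that by simp_all
  have pos: "0 < 1 + X z $ i" "0 < 1 - X z $ i" "0 < MuL z $ i" "0 < MuR z $ i" if "i < n" for i
    using z that Omega_bounds[of "X z" i] by (auto simp: interior_point_def)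
  have dL: "MuL d $ i = - (MuL z $ i / (1 + X z $ i)) * X d $ i" if "i < n" for i
    using eqL[OF that] pos[OF that] by (simp add: field_simps)
  have dR: "MuR d $ i = MuR z $ i / (1 - X z $ i) * X d $ i" if "i < n" for i
    using eqR[OF that] pos[OF that] by (simp add: field_simps)
  have "(\<Sum>i<n. X d $ i * (MuL d $ i - MuR d $ i)) \<le> 0"
  proof (rule sum_nonpos)
    fix i
    assume "i \<in> {..<n}"
    then have i: "i < n" by simp
    have "X d $ i * (MuL d $ i - MuR d $ i) =
        - ((MuL z $ i / (1 + X z $ i) + MuR z $ i / (1 - X z $ i)) * (X d $ i)\<^sup>2)"
      by (simp add: dL[OF i] dR[OF i] algebra_simps power2_eq_square)
    also have "\<dots> \<le> 0" using pos[OF i] by simp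
    finally show "X d $ i * (MuL d $ i - MuR d $ i) \<le> 0" .
  qed
  then have le: "X d \<bullet> (Q *\<^sub>v X d) + omega * (norm2 (X d))\<^sup>2 + omega * (norm2 (Lam d))\<^sup>2 \<le> 0"
    using energy_identity[OF d eqs(2)] by (simp add: eqs(1) scalar_prod_right_zero[of _ n])
  have nn: "0 \<le> X d \<bullet> (Q *\<^sub>v X d)" "0 \<le> omega * (norm2 (X d))\<^sup>2" "0 \<le> omega * (norm2 (Lam d))\<^sup>2"
    using Q_psd[of "X d"] omega_pos by simp_all
  have "omega * (norm2 (X d))\<^sup>2 = 0" "omega * (norm2 (Lam d))\<^sup>2 = 0" using le nn by linarith+
  then have "norm2 (X d) = 0" "norm2 (Lam d) = 0" using omega_pos by simp_all
  then have X0: "X d = 0\<^sub>v n" and L0: "Lam d = 0\<^sub>v m" using norm2_eq_0D by auto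
  have "MuL d $ i = 0" "MuR d $ i = 0" if "i < n" for i
    using dL[OF that] dR[OF that] that unfolding X0 by auto
  then have "MuL d = 0\<^sub>v n" "MuR d = 0\<^sub>v n"
    by (intro eq_vecI; simp)+
  then show ?thesis using d X0 L0 by - (rule block_eqI; simp)
qed

lemma solve_DF:
  assumes z: "interior_point z" and r: "r \<in> carrier_vec N"
  obtains d where "solve (DF z) r ds = Some (d, N # ds)" "d \<in> carrier_vec N" "dF z d = r"
proof -
  have zc: "z \<in> carrier_vec N" using z by (simp add: interior_point_def)
  show thesis
  proof (rule solve_eq_Some[OF DF_carrier[OF zc] r DF_kernel[OF z]])
    fix d
    assume "solve (DF z) r ds = Some (d, N # ds)" "d \<in> carrier_vec N" "DF z *\<^sub>v d = r"
    then show thesis using DF_mult[OF zc, of d] by (intro that) auto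
  qed
qed

section \<open>Initialization and path-following\<close>

text \<open>
  The squared Euclidean norm of the two complementarity components of \<open>F \<tau> z\<close>.
\<close>

definition comp_res :: "real \<Rightarrow> real vec \<Rightarrow> real" where
  "comp_res \<tau> z = (\<Sum>i<n. (MuL z $ i * (1 + X z $ i) - \<tau>)\<^sup>2 + (MuR z $ i * (1 - X z $ i) - \<tau>)\<^sup>2)"

text \<open>
  The neighbourhood of the central path: the affine equations hold exactly, and the complementarity
  products have relative distance at most \<open>\<theta>\<close> from \<open>\<tau>\<close>.
\<close>

definition path_point :: "real \<Rightarrow> real vec \<Rightarrow> bool" where
  "path_point \<tau> z \<longleftrightarrow> interior_point z \<and> F1 z = 0\<^sub>v n \<and> F2 z = 0\<^sub>v m \<and> comp_res \<tau> z \<le> (theta * \<tau>)\<^sup>2"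

lemma F12_minus:
  assumes "z \<in> carrier_vec N" "d \<in> carrier_vec N"
  shows "F1 (z - d) = F1 z - dF1 d" "F2 (z - d) = F2 z - dF2 d"
proof -
  have "z - d = z + (-1) \<cdot>\<^sub>v d" using assms by auto
  moreover have "F1 z + (-1) \<cdot>\<^sub>v dF1 d = F1 z - dF1 d" "F2 z + (-1) \<cdot>\<^sub>v dF2 d = F2 z - dF2 d"
    using F12_carrier[of z] dF12_carrier[of d] by auto
  ultimately show "F1 (z - d) = F1 z - dF1 d" "F2 (z - d) = F2 z - dF2 d"
    using F1_line[OF assms, of "-1"] by simp_all
qed

lemma comp_res_component_le:
  assumes "i < n"
  shows "(MuL z $ i * (1 + X z $ i) - \<tau>)\<^sup>2 \<le> comp_res \<tau> z"
    and "(MuR z $ i * (1 - X z $ i) - \<tau>)\<^sup>2 \<le> comp_res \<tau> z"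
proof -
  have "(MuL z $ i * (1 + X z $ i) - \<tau>)\<^sup>2 + (MuR z $ i * (1 - X z $ i) - \<tau>)\<^sup>2 \<le> comp_res \<tau> z"
    unfolding comp_res_def using assms
    by (intro member_le_sum[of i "{..<n}" "\<lambda>i. (MuL z $ i * (1 + X z $ i) - \<tau>)\<^sup>2 + (MuR z $ i * (1 - X z $ i) - \<tau>)\<^sup>2"]) auto
  then show "(MuL z $ i * (1 + X z $ i) - \<tau>)\<^sup>2 \<le> comp_res \<tau> z"
    and "(MuR z $ i * (1 - X z $ i) - \<tau>)\<^sup>2 \<le> comp_res \<tau> z"
    using zero_le_power2[of "MuL z $ i * (1 + X z $ i) - \<tau>"]
      zero_le_power2[of "MuR z $ i * (1 - X z $ i) - \<tau>"] by linarith+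
qed

lemma comp_products:
  assumes "comp_res \<tau> z \<le> (theta * \<tau>)\<^sup>2" "0 < \<tau>" "i < n"
  shows "7 / 10 * \<tau> \<le> MuL z $ i * (1 + X z $ i)" "7 / 10 * \<tau> \<le> MuR z $ i * (1 - X z $ i)"
    and "MuL z $ i * (1 + X z $ i) \<le> 13 / 10 * \<tau>" "MuR z $ i * (1 - X z $ i) \<le> 13 / 10 * \<tau>"
proof -
  have *: "7 / 10 * \<tau> \<le> p \<and> p \<le> 13 / 10 * \<tau>" if "(p - \<tau>)\<^sup>2 \<le> comp_res \<tau> z" for p
  proof -
    have "\<bar>p - \<tau>\<bar>\<^sup>2 \<le> (theta * \<tau>)\<^sup>2" using that assms(1) by simp
    then have "\<bar>p - \<tau>\<bar> \<le> theta * \<tau>"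
      using assms(2) by (intro power2_le_imp_le[of "\<bar>p - \<tau>\<bar>"]) (auto simp: theta_def)
    then show ?thesis using assms(2) unfolding theta_def by linarith
  qed
  show "7 / 10 * \<tau> \<le> MuL z $ i * (1 + X z $ i)" "MuL z $ i * (1 + X z $ i) \<le> 13 / 10 * \<tau>"
    using *[OF comp_res_component_le(1)[OF assms(3)]] by auto
  show "7 / 10 * \<tau> \<le> MuR z $ i * (1 - X z $ i)" "MuR z $ i * (1 - X z $ i) \<le> 13 / 10 * \<tau>"
    using *[OF comp_res_component_le(2)[OF assms(3)]] by auto
qed

lemma interior_pos:
  assumes "interior_point z" "i < n"
  shows "0 < 1 + X z $ i" "0 < 1 - X z $ i" "0 < MuL z $ i" "0 < MuR z $ i"
  using assms Omega_bounds[of "X z" i] by (auto simp: interior_point_def)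

lemma interior_pointI:
  assumes "z \<in> carrier_vec N"
    "\<And>i. i < n \<Longrightarrow> 0 < 1 + X z $ i \<and> 0 < 1 - X z $ i \<and> 0 < MuL z $ i \<and> 0 < MuR z $ i"
  shows "interior_point z"
  using assms n_pos by (fastforce simp: interior_point_def Omega_iff)

lemma newton_step:
  assumes z: "interior_point z" and feas: "F1 z = 0\<^sub>v n" "F2 z = 0\<^sub>v m"
    and d: "d \<in> carrier_vec N" and eq: "dF z d = F \<tau> z"
    and res: "comp_res \<tau> z \<le> eta"
    and kap: "0 < kap" "\<And>i. i < n \<Longrightarrow> kap \<le> MuL z $ i * (1 + X z $ i)"
      "\<And>i. i < n \<Longrightarrow> kap \<le> MuR z $ i * (1 - X z $ i)"
    and zeta: "(eta / kap)\<^sup>2 / 8 \<le> zeta" "zeta < \<tau>\<^sup>2" and tau: "0 < \<tau>"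
  shows "interior_point (z - d)" "F1 (z - d) = 0\<^sub>v n" "F2 (z - d) = 0\<^sub>v m" "comp_res \<tau> (z - d) \<le> zeta"
proof -
  have zc: "z \<in> carrier_vec N" using z by (simp add: interior_point_def)
  have blocks: "X (dF z d) = X (F \<tau> z)" "Lam (dF z d) = Lam (F \<tau> z)"
    "MuL (dF z d) = MuL (F \<tau> z)" "MuR (dF z d) = MuR (F \<tau> z)" by (simp_all only: eq)
  then have d12: "dF1 d = 0\<^sub>v n" "dF2 d = 0\<^sub>v m" using feas by simp_all
  have eqL: "MuL z $ i * X d $ i + (1 + X z $ i) * MuL d $ i = MuL z $ i * (1 + X z $ i) - \<tau>"
    and eqR: "MuR z $ i * - X d $ i + (1 - X z $ i) * MuR d $ i = MuR z $ i * (1 - X z $ i) - \<tau>"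
    if "i < n" for i
    using arg_cong[OF blocks(3), of "\<lambda>v. v $ i"] arg_cong[OF blocks(4), of "\<lambda>v. v $ i"] that by simp_all
  show "F1 (z - d) = 0\<^sub>v n" "F2 (z - d) = 0\<^sub>v m"
    by (simp_all add: F12_minus[OF zc d] feas d12)
  \<comment> \<open>The two families of complementarity conditions are treated as one, indexed by a disjoint sum.\<close>
  define I where "I = {..<n} <+> {..<n}"
  define s where "s = case_sum (\<lambda>i. 1 + X z $ i) (\<lambda>i. 1 - X z $ i)"
  define mu where "mu = case_sum (\<lambda>i. MuL z $ i) (\<lambda>i. MuR z $ i)"
  define ds where "ds = case_sum (\<lambda>i. X d $ i) (\<lambda>i. - X d $ i)"
  define dmu where "dmu = case_sum (\<lambda>i. MuL d $ i) (\<lambda>i. MuR d $ i)"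
  note defs = I_def s_def mu_def ds_def dmu_def
  have "(\<Sum>i\<in>I. ds i * dmu i) = (\<Sum>i<n. X d $ i * (MuL d $ i - MuR d $ i))"
    by (simp add: defs sum.Plus sum_subtractf right_diff_distrib sum_negf)
  also have "\<dots> \<ge> 0"
    using Q_psd[of "X d"] omega_pos
    by (simp add: energy_identity[OF d d12(2)] d12(1) scalar_prod_right_zero[of _ n])
  finally have mono: "0 \<le> (\<Sum>i\<in>I. ds i * dmu i)" .
  have ressum: "(\<Sum>i\<in>I. (mu i * s i - \<tau>)\<^sup>2) = comp_res \<tau> z"
    by (simp add: defs sum.Plus comp_res_def sum.distrib)
  have prods: "(\<Sum>i\<in>I. (ds i * dmu i)\<^sup>2) \<le> (eta / kap)\<^sup>2 / 8"
  proof (rule newton_products[where s = s and mu = mu and tau = \<tau>])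
    show "finite I" by (simp add: I_def)
    show "(\<Sum>i\<in>I. (mu i * s i - \<tau>)\<^sup>2) \<le> eta" using res by (simp add: ressum)
  qed (use interior_pos[OF z] kap eqL eqR mono in \<open>auto simp: defs\<close>)
  have split: "(\<Sum>i\<in>I. (ds i * dmu i)\<^sup>2) = (\<Sum>i<n. (X d $ i * MuL d $ i)\<^sup>2 + (- X d $ i * MuR d $ i)\<^sup>2)"
    by (simp add: defs sum.Plus sum.distrib)
  have small: "\<bar>X d $ i * MuL d $ i\<bar> < \<tau>" "\<bar>- X d $ i * MuR d $ i\<bar> < \<tau>" if "i < n" for i
  proof -
    have "(X d $ i * MuL d $ i)\<^sup>2 + (- X d $ i * MuR d $ i)\<^sup>2 \<le> (\<Sum>i\<in>I. (ds i * dmu i)\<^sup>2)"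
      unfolding split using that
      by (intro member_le_sum[of i "{..<n}" "\<lambda>i. (X d $ i * MuL d $ i)\<^sup>2 + (- X d $ i * MuR d $ i)\<^sup>2"]) auto
    then have "(X d $ i * MuL d $ i)\<^sup>2 < \<tau>\<^sup>2" "(- X d $ i * MuR d $ i)\<^sup>2 < \<tau>\<^sup>2"
      using prods zeta zero_le_power2[of "X d $ i * MuL d $ i"] zero_le_power2[of "- X d $ i * MuR d $ i"]
      by linarith+
    then have "\<bar>X d $ i * MuL d $ i\<bar>\<^sup>2 < \<tau>\<^sup>2" "\<bar>- X d $ i * MuR d $ i\<bar>\<^sup>2 < \<tau>\<^sup>2" by simp_all
    then show "\<bar>X d $ i * MuL d $ i\<bar> < \<tau>" "\<bar>- X d $ i * MuR d $ i\<bar> < \<tau>"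
      using tau by - (rule power2_less_imp_less, assumption, simp)+
  qed
  have L: "0 < (1 + X z $ i) - X d $ i" "0 < MuL z $ i - MuL d $ i"
     "(MuL z $ i - MuL d $ i) * ((1 + X z $ i) - X d $ i) - \<tau> = X d $ i * MuL d $ i" if "i < n" for i
    using newton_positive[OF interior_pos(1,3)[OF z that] eqL[OF that] small(1)[OF that]] by blast+
  have R: "0 < (1 - X z $ i) - - X d $ i" "0 < MuR z $ i - MuR d $ i"
     "(MuR z $ i - MuR d $ i) * ((1 - X z $ i) - - X d $ i) - \<tau> = - X d $ i * MuR d $ i" if "i < n" for i
    using newton_positive[OF interior_pos(2,4)[OF z that] eqR[OF that] small(2)[OF that]] by blast+
  show "interior_point (z - d)"
    using zc d L(1,2) R(1,2) by (intro interior_pointI) (auto simp: algebra_simps)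
  have "comp_res \<tau> (z - d) = (\<Sum>i<n. ((MuL z $ i - MuL d $ i) * ((1 + X z $ i) - X d $ i) - \<tau>)\<^sup>2
     + ((MuR z $ i - MuR d $ i) * ((1 - X z $ i) - - X d $ i) - \<tau>)\<^sup>2)"
    unfolding comp_res_def using zc d by (intro sum.cong refl) (simp add: algebra_simps)
  also have "\<dots> = (\<Sum>i\<in>I. (ds i * dmu i)\<^sup>2)"
    unfolding split by (intro sum.cong refl) (simp only: L(3) R(3) lessThan_iff)
  finally show "comp_res \<tau> (z - d) \<le> zeta" using prods zeta by simp
qed

lemma sigma_bounds: "78 / 100 \<le> sigma" "sigma < 1" "(1 - sigma)\<^sup>2 * (2 * real n) = (9 / 100)"
proof -
  have "(14 / 10)\<^sup>2 \<le> 2 * real n" using n_pos by (simp add: power2_eq_square)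
  then have s: "14 / 10 \<le> sqrt (2 * real n)" by (rule real_le_rsqrt)
  then have "3 / 10 / sqrt (2 * real n) \<le> 3 / 10 / (14 / 10)"
    using n_pos by (intro divide_left_mono) auto
  then show "78 / 100 \<le> sigma" by (simp add: sigma_def beta_def theta_def)
  show "sigma < 1" using n_pos by (simp add: sigma_def beta_def theta_def)
  show "(1 - sigma)\<^sup>2 * (2 * real n) = (9 / 100)"
    using n_pos by (simp add: sigma_def beta_def theta_def power_divide)
qed

lemma linear_part_F: "linear_part (F \<tau> z) = join (F1 z) (F2 z) (0\<^sub>v n) (0\<^sub>v n)"
proof -
  have "vec_block 0 (n + m) (F \<tau> z) = F1 z @\<^sub>v F2 z"
    by (rule eq_vecI)
      (auto simp: vec_block_def F_join join_def carrier_vecD[OF F12_carrier(1)] carrier_vecD[OF F12_carrier(2)])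
  moreover have "0\<^sub>v (2 * n) = 0\<^sub>v n @\<^sub>v (0\<^sub>v n :: real vec)"
    by (rule eq_vecI) auto
  ultimately show ?thesis
    by (auto simp: linear_part_def join_def intro!: eq_vecI)
qed

text \<open>
  The residual before the first Newton step is at most \<open>(0.6 \<tau>)\<^sup>2\<close> and the products are at least \<open>0.7 \<tau>\<close>, so
  \<open>newton_step\<close> yields a residual of at most \<open>(0.36 / 0.7)\<^sup>2 / 8 \<tau>\<^sup>2\<close>, which is below \<open>(\<theta> \<sigma> \<tau>)\<^sup>2\<close> because \<open>\<sigma> \<ge> 0.78\<close>.
\<close>

lemma path_step_Some:
  assumes pz: "path_point \<tau> z" and tau: "0 < \<tau>"
  shows "\<exists>z'. path_step (sigma * \<tau>) z ds = Some (z', N # N # N # ds) \<and> path_point (sigma * \<tau>) z'"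
proof -
  define \<tau>' where "\<tau>' = sigma * \<tau>"
  have tau': "0 < \<tau>'" using tau sigma_bounds by (simp add: \<tau>'_def)
  have z: "interior_point z" "F1 z = 0\<^sub>v n" "F2 z = 0\<^sub>v m" "comp_res \<tau> z \<le> (theta * \<tau>)\<^sup>2"
    using pz by (auto simp: path_point_def)
  obtain d1 where d1: "solve (DF z) (F \<tau>' z) ds = Some (d1, N # ds)" "d1 \<in> carrier_vec N" "dF z d1 = F \<tau>' z"
    using solve_DF[OF z(1) F_carrier] by metis
  \<comment> \<open>Changing the target from \<open>\<tau>\<close> to \<open>\<sigma> \<tau>\<close> raises the residual bound from \<open>(\<theta> \<tau>)\<^sup>2\<close> to \<open>(2 \<theta> \<tau>)\<^sup>2\<close>, as \<open>\<beta> = \<theta>\<close>.\<close>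
  have "comp_res \<tau>' z \<le> (\<Sum>i<n. 2 * ((MuL z $ i * (1 + X z $ i) - \<tau>)\<^sup>2 + (MuR z $ i * (1 - X z $ i) - \<tau>)\<^sup>2)
     + 4 * (\<tau> - \<tau>')\<^sup>2)"
    unfolding comp_res_def
  proof (rule sum_mono)
    fix i
    have *: "(p - \<tau>')\<^sup>2 \<le> 2 * (p - \<tau>)\<^sup>2 + 2 * (\<tau> - \<tau>')\<^sup>2" for p
    proof -
      have "0 \<le> ((p - \<tau>) - (\<tau> - \<tau>'))\<^sup>2" by simp
      then show ?thesis by (simp add: power2_eq_square algebra_simps)
    qed
    show "(MuL z $ i * (1 + X z $ i) - \<tau>')\<^sup>2 + (MuR z $ i * (1 - X z $ i) - \<tau>')\<^sup>2
      \<le> 2 * ((MuL z $ i * (1 + X z $ i) - \<tau>)\<^sup>2 + (MuR z $ i * (1 - X z $ i) - \<tau>)\<^sup>2) + 4 * (\<tau> - \<tau>')\<^sup>2"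
      using *[of "MuL z $ i * (1 + X z $ i)"] *[of "MuR z $ i * (1 - X z $ i)"] by simp
  qed
  also have "\<dots> = 2 * comp_res \<tau> z + 2 * ((1 - sigma)\<^sup>2 * (2 * real n)) * \<tau>\<^sup>2"
    by (simp add: comp_res_def sum.distrib sum_distrib_left \<tau>'_def)
      (simp add: power2_eq_square algebra_simps)
  also have "\<dots> \<le> 36 / 100 * \<tau>\<^sup>2"
    unfolding sigma_bounds(3) using z(4) by (simp add: theta_def power_mult_distrib power2_eq_square)
  finally have res1: "comp_res \<tau>' z \<le> 36 / 100 * \<tau>\<^sup>2" .
  have "(36 / 100 * \<tau>\<^sup>2 / (7 / 10 * \<tau>))\<^sup>2 / 8 = (36 / 70)\<^sup>2 / 8 * \<tau>\<^sup>2"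
    using tau by (simp add: power2_eq_square)
  also have "\<dots> \<le> (3 / 10 * (78 / 100))\<^sup>2 * \<tau>\<^sup>2"
    by (intro mult_right_mono) (simp_all add: power2_eq_square)
  also have "\<dots> \<le> (theta * \<tau>')\<^sup>2"
    unfolding power_mult_distrib[symmetric] theta_def \<tau>'_def using sigma_bounds(1) tau
    by (intro power_mono) auto
  finally have zeta1: "(36 / 100 * \<tau>\<^sup>2 / (7 / 10 * \<tau>))\<^sup>2 / 8 \<le> (theta * \<tau>')\<^sup>2" .
  have zeta_less: "(theta * \<tau>')\<^sup>2 < \<tau>'\<^sup>2"
    using tau' by (simp add: theta_def power_mult_distrib power2_eq_square)
  have "0 < 7 / 10 * \<tau>" using tau by simp
  note step1 = newton_step[OF z(1-3) d1(2,3) res1 this comp_products(1,2)[OF z(4) tau] zeta1 zeta_less tau']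
  define z1 where "z1 = z - d1"
  note z1 = step1[folded z1_def]
  obtain d2 where d2: "solve (DF z1) (F \<tau>' z1) (N # ds) = Some (d2, N # N # ds)" "d2 \<in> carrier_vec N"
      "dF z1 d2 = F \<tau>' z1"
    using solve_DF[OF z1(1) F_carrier] by metis
  have "((theta * \<tau>')\<^sup>2 / (7 / 10 * \<tau>'))\<^sup>2 / 8 \<le> (theta * \<tau>')\<^sup>2"
    using tau' by (simp add: theta_def power2_eq_square)
  moreover have "0 < 7 / 10 * \<tau>'" using tau' by simp
  ultimately have step2: "interior_point (z1 - d2)" "F1 (z1 - d2) = 0\<^sub>v n" "F2 (z1 - d2) = 0\<^sub>v m"
      "comp_res \<tau>' (z1 - d2) \<le> (theta * \<tau>')\<^sup>2"
    using newton_step[OF z1(1-3) d2(2,3) z1(4) _ comp_products(1,2)[OF z1(4) tau'] _ zeta_less tau'] by blast+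
  define z2 where "z2 = z1 - d2"
  note z2 = step2[folded z2_def]
  \<comment> \<open>In exact arithmetic the correction of the linear residuals does nothing.\<close>
  have lin: "linear_part (F \<tau>' z2) = 0\<^sub>v N"
    by (rule block_eqI) (simp_all add: linear_part_F z2)
  obtain d3 where d3: "solve (DF z2) (linear_part (F \<tau>' z2)) (N # N # ds) = Some (d3, N # N # N # ds)"
      "d3 \<in> carrier_vec N" "dF z2 d3 = 0\<^sub>v N"
    unfolding lin using solve_DF[OF z2(1) zero_carrier_vec] by metis
  have z2c: "z2 \<in> carrier_vec N" using z2 by (simp add: interior_point_def)
  have "d3 = 0\<^sub>v N" using DF_kernel[OF z2(1) d3(2)] d3(3) by (simp add: DF_mult[OF z2c d3(2)])
  then have "z2 - d3 = z2" using z2c by auto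
  then have "path_step \<tau>' z ds = Some (z2, N # N # N # ds)"
    by (simp add: path_step_def d1(1) z1_def[symmetric] d2(1) z2_def[symmetric] d3(1) Let_def)
  moreover have "path_point \<tau>' z2" using z2 by (simp add: path_point_def)
  ultimately show ?thesis unfolding \<tau>'_def by blast
qed

text \<open>
  The loop ends because \<open>tau_E\<close> has been reached or after \<open>k\<close> steps; in the second case \<open>\<tau>\<close> has shrunk by \<open>sigma ^ k\<close>.
\<close>

lemma path_following_Some:
  assumes "path_point \<tau> z" "0 < \<tau>"
  shows "\<exists>z' it' ds' \<tau>'. path_following k \<tau> z it ds = Some (z', it', ds') \<and> path_point \<tau>' z' \<and> 0 < \<tau>'
     \<and> (\<tau>' \<le> tau_E \<or> \<tau>' = sigma ^ k * \<tau>) \<and> it' \<le> it + k \<and> length ds' \<le> length ds + 3 * k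
     \<and> set ds' \<subseteq> insert N (set ds)"
  using assms
proof (induction k arbitrary: \<tau> z it ds)
  case 0
  then show ?case by auto
next
  case (Suc k)
  obtain z1 where z1: "path_step (sigma * \<tau>) z ds = Some (z1, N # N # N # ds)" "path_point (sigma * \<tau>) z1"
    using path_step_Some[OF Suc.prems] by blast
  have pos: "0 < sigma * \<tau>" using Suc.prems sigma_bounds by simp
  show ?case
  proof (cases "sigma * \<tau> \<le> tau_E")
    case True
    then show ?thesis using z1 pos by (auto simp: Let_def)
  next
    case False
    obtain z' it' ds' \<tau>' where "path_following k (sigma * \<tau>) z1 (Suc it) (N # N # N # ds) = Some (z', it', ds')"
      "path_point \<tau>' z'" "0 < \<tau>'" "\<tau>' \<le> tau_E \<or> \<tau>' = sigma ^ k * (sigma * \<tau>)" "it' \<le> Suc it + k"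
      "length ds' \<le> length (N # N # N # ds) + 3 * k" "set ds' \<subseteq> insert N (set (N # N # N # ds))"
      using Suc.IH[OF z1(2) pos, of "Suc it" "N # N # N # ds"] by blast
    then show ?thesis
      using z1(1) False by (auto simp: Let_def ac_simps intro!: exI[of _ \<tau>'])
  qed
qed

lemma divide_cw_Some:
  assumes "\<And>i. i < dim_vec v \<Longrightarrow> v $ i \<noteq> 0"
  shows "divide_cw s v = Some (vec (dim_vec v) (\<lambda>i. s / v $ i))"
  using assms by (simp add: divide_cw_def)

lemma initialization_Some:
  "\<exists>z ds. initialization = Some (z, ds) \<and> path_point tau_A z \<and> length ds = K + 1 \<and> (\<forall>d\<in>set ds. d \<le> N)"
proof -
  obtain x ds where x: "centering K = Some (x, ds)" "centered x" "length ds = K" "\<forall>d\<in>set ds. d \<le> N"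
    using centering_Some by blast
  have xO: "x \<in> Omega n" using x(2) by (simp add: centered_def)
  have xc: "x \<in> carrier_vec n" using xO by (rule Omega_carrier)
  note xpos = Omega_bounds[OF xO]
  define p where "p = vec n (\<lambda>i. tau_A / (1 + x $ i))"
  define q where "q = vec n (\<lambda>i. tau_A / (1 - x $ i))"
  define l where "l = (- (1 / omega)) \<cdot>\<^sub>v (A *\<^sub>v x - b)"
  have div: "divide_cw tau_A (ones_vec n + x) = Some p" "divide_cw tau_A (ones_vec n - x) = Some q"
    unfolding p_def q_def using xc xpos
    by (subst divide_cw_Some; force simp: ones_vec_def intro!: eq_vecI)+
  define z where "z = join x l p q"
  have carr: "x \<in> carrier_vec n" "l \<in> carrier_vec m" "p \<in> carrier_vec n" "q \<in> carrier_vec n"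
    using xc A b by (auto simp: l_def p_def q_def)
  have zc: "z \<in> carrier_vec N" using carr by (simp add: z_def)
  note zb = block_join[OF carr, folded z_def]
  have zi: "interior_point z"
    using zc xpos tau_A_pos by (intro interior_pointI) (auto simp: zb p_def q_def)
  have F2z: "F2 z = 0\<^sub>v m"
    using A b carr omega_pos by (intro eq_vecI) (auto simp: F2_def zb l_def)
  have F1z: "F1 z $ i = tau_A * gradient f x $ i" if i: "i < n" for i
  proof -
    have "transpose_mat A *\<^sub>v l = (- (1 / omega)) \<cdot>\<^sub>v (transpose_mat A *\<^sub>v (A *\<^sub>v x - b))"
      unfolding l_def using A b xc by (intro mult_mat_vec[of _ n m]) auto
    moreover have "tau_A * gradient f x $ i = grad_phi x $ i - tau_A / (1 + x $ i) + tau_A / (1 - x $ i)"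
      using tau_A_pos by (simp add: gradient_f[OF xO i] distrib_left right_diff_distrib)
    ultimately show ?thesis
      using i Q A b c xc by (simp add: F1_def zb grad_phi_def p_def q_def)
  qed
  obtain d where d: "solve (DF z) (linear_part (F tau_A z)) ds = Some (d, N # ds)" "d \<in> carrier_vec N"
      "dF z d = linear_part (F tau_A z)"
    using solve_DF[OF zi, of "linear_part (F tau_A z)" ds] by (metis linear_part_F join_carrier F12_carrier zero_carrier_vec)
  have init: "initialization = Some (z - d, N # ds)"
    using x(1) div d(1) unfolding initialization_def z_def join_def l_def by (simp add: Let_def)
  have eqs: "dF1 d = F1 z" "dF2 d = 0\<^sub>v m" "MuL (dF z d) = 0\<^sub>v n" "MuR (dF z d) = 0\<^sub>v n"
    using arg_cong[OF d(3), of X] arg_cong[OF d(3), of Lam] arg_cong[OF d(3), of MuL] arg_cong[OF d(3), of MuR]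
    by (simp_all add: linear_part_F F2z)
  have elim: "w = - (r / s\<^sup>2) * y" if "0 < s" "r / s * y + s * w = 0" for r s w y :: real
    using that by (simp add: field_simps power2_eq_square)
  have dL: "MuL d $ i = - (tau_A / (1 + x $ i)\<^sup>2) * X d $ i" and dR: "MuR d $ i = tau_A / (1 - x $ i)\<^sup>2 * X d $ i"
    if i: "i < n" for i
  proof -
    have "tau_A / (1 + x $ i) * X d $ i + (1 + x $ i) * MuL d $ i = 0"
      "- (tau_A / (1 - x $ i) * X d $ i) + (1 - x $ i) * MuR d $ i = 0"
      using arg_cong[OF eqs(3), of "\<lambda>v. v $ i"] arg_cong[OF eqs(4), of "\<lambda>v. v $ i"] i
      by (simp_all add: zb p_def q_def)
    then show "MuL d $ i = - (tau_A / (1 + x $ i)\<^sup>2) * X d $ i" "MuR d $ i = tau_A / (1 - x $ i)\<^sup>2 * X d $ i"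
      using elim[of "1 + x $ i" tau_A "X d $ i"] elim[of "1 - x $ i" tau_A "- X d $ i"] xpos[OF i] by simp_all
  qed
  \<comment> \<open>The primal part of the correction is the next Newton step of the barrier function.\<close>
  have "hessian f x *\<^sub>v X d = gradient f x"
  proof (rule eq_vecI)
    fix i
    assume "i < dim_vec (gradient f x)"
    then have i: "i < n" using gradient_f_carrier[OF xc] by auto
    have "Lam d = (- (1 / omega)) \<cdot>\<^sub>v (A *\<^sub>v X d)"
    proof (rule eq_vecI)
      fix j
      assume "j < dim_vec (- (1 / omega) \<cdot>\<^sub>v (A *\<^sub>v X d))"
      then have "j < m" using A by simp
      then show "Lam d $ j = (- (1 / omega) \<cdot>\<^sub>v (A *\<^sub>v X d)) $ j"
        using arg_cong[OF eqs(2), of "\<lambda>v. v $ j"] A omega_pos by (simp add: dF2_def field_simps)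
    qed (use A in simp)
    then have "transpose_mat A *\<^sub>v Lam d = (- (1 / omega)) \<cdot>\<^sub>v (transpose_mat A *\<^sub>v (A *\<^sub>v X d))"
      using A by (simp add: mult_mat_vec[of _ n m])
    then have "dF1 d $ i = G (X d) $ i + tau_A * ((1 / (1 + x $ i)\<^sup>2 + 1 / (1 - x $ i)\<^sup>2) * X d $ i)"
      using i Q A by (simp add: dF1_def G_def dL dR algebra_simps)
    then have "G (X d) $ i + tau_A * ((1 / (1 + x $ i)\<^sup>2 + 1 / (1 - x $ i)\<^sup>2) * X d $ i) = tau_A * gradient f x $ i"
      using eqs(1) F1z[OF i] by simp
    then show "(hessian f x *\<^sub>v X d) $ i = gradient f x $ i"
      using tau_A_pos by (simp add: hessian_f_mult[OF xO i] field_simps)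
  qed (use hessian_f_carrier[OF xc] gradient_f_carrier[OF xc] in auto)
  then have ls: "local_sq x (X d) \<le> 1 / 32" using x(2) by (simp add: centered_def)
  have small: "(X d $ i / (1 + x $ i))\<^sup>2 \<le> 1 / 32" "(X d $ i / (1 - x $ i))\<^sup>2 \<le> 1 / 32" if "i < n" for i
    using local_sq_component_le[OF that, of "X d" x] ls
      zero_le_power2[of "X d $ i / (1 + x $ i)"] zero_le_power2[of "X d $ i / (1 - x $ i)"] by linarith+
  have factor: "r / s - - (r / s\<^sup>2) * y = r / s * (1 + y / s)" "r / s - r / s\<^sup>2 * y = r / s * (1 - y / s)"
    "s - y = s * (1 - y / s)" "s + y = s * (1 + y / s)" if "0 < s" for r s y :: real
    using that by (simp_all add: field_simps power2_eq_square)
  have prodL: "MuL (z - d) $ i = tau_A / (1 + x $ i) * (1 + X d $ i / (1 + x $ i))"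
    "1 + X (z - d) $ i = (1 + x $ i) * (1 - X d $ i / (1 + x $ i))"
    and prodR: "MuR (z - d) $ i = tau_A / (1 - x $ i) * (1 - X d $ i / (1 - x $ i))"
    "1 - X (z - d) $ i = (1 - x $ i) * (1 + X d $ i / (1 - x $ i))" if i: "i < n" for i
    using factor(1)[of "1 + x $ i" tau_A "X d $ i"] factor(2)[of "1 - x $ i" tau_A "X d $ i"]
      factor(3)[of "1 + x $ i" "X d $ i"] factor(4)[of "1 - x $ i" "X d $ i"] xpos[OF i] zc d(2) i
    by (simp_all add: zb dL[OF i] dR[OF i] p_def q_def add_diff_eq[symmetric] diff_add_eq)
  have lt1: "\<bar>X d $ i / (1 + x $ i)\<bar> < 1" "\<bar>X d $ i / (1 - x $ i)\<bar> < 1" if "i < n" for i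
    using small[OF that] by (simp_all only: abs_square_less_1[symmetric])
  have "interior_point (z - d)"
  proof (rule interior_pointI)
    fix i
    assume i: "i < n"
    show "0 < 1 + X (z - d) $ i \<and> 0 < 1 - X (z - d) $ i \<and> 0 < MuL (z - d) $ i \<and> 0 < MuR (z - d) $ i"
    proof -
      have pos: "0 < 1 + X d $ i / (1 + x $ i)" "0 < 1 - X d $ i / (1 + x $ i)"
        "0 < 1 + X d $ i / (1 - x $ i)" "0 < 1 - X d $ i / (1 - x $ i)"
        using lt1[OF i] unfolding abs_less_iff by linarith+
      show ?thesis
        unfolding prodL[OF i] prodR[OF i]
        using xpos[OF i] tau_A_pos by (intro conjI mult_pos_pos divide_pos_pos pos) auto
    qed
  qed (use zc d in simp)
  moreover have "F1 (z - d) = 0\<^sub>v n" "F2 (z - d) = 0\<^sub>v m"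
    by (auto simp: F12_minus[OF zc d(2)] eqs F2z)
  moreover have "comp_res tau_A (z - d) \<le> (theta * tau_A)\<^sup>2"
  proof -
    have "comp_res tau_A (z - d) \<le> (\<Sum>i<n. tau_A\<^sup>2 * ((X d $ i / (1 + x $ i))\<^sup>2 + (X d $ i / (1 - x $ i))\<^sup>2))"
      unfolding comp_res_def
    proof (rule sum_mono)
      fix i
      assume "i \<in> {..<n}"
      then have i: "i < n" by simp
      define s where "s = X d $ i / (1 + x $ i)"
      define t where "t = X d $ i / (1 - x $ i)"
      have cancel: "tau_A / w * u * (w * v) = tau_A * (u * v)" if "0 < w" for w u v :: real
        using that by simp
      have st: "s\<^sup>2 \<le> 1" "t\<^sup>2 \<le> 1" using small[OF i] by (simp_all add: s_def t_def)
      have "MuL (z - d) $ i * (1 + X (z - d) $ i) - tau_A = - (tau_A * s\<^sup>2)"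
        "MuR (z - d) $ i * (1 - X (z - d) $ i) - tau_A = - (tau_A * t\<^sup>2)"
        unfolding prodL[OF i] prodR[OF i] s_def[symmetric] t_def[symmetric]
        using cancel[of "1 + x $ i" "1 + s" "1 - s"] cancel[of "1 - x $ i" "1 - t" "1 + t"] xpos[OF i]
        by (simp_all only:) (simp_all add: power2_eq_square algebra_simps)
      moreover have "(tau_A * s\<^sup>2)\<^sup>2 \<le> tau_A\<^sup>2 * s\<^sup>2" "(tau_A * t\<^sup>2)\<^sup>2 \<le> tau_A\<^sup>2 * t\<^sup>2"
        unfolding power_mult_distrib power2_eq_square[of "s\<^sup>2"] power2_eq_square[of "t\<^sup>2"]
        using mult_left_le[of "s\<^sup>2" "s\<^sup>2"] mult_left_le[of "t\<^sup>2" "t\<^sup>2"] st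
        by (auto intro!: mult_left_mono)
      ultimately show "(MuL (z - d) $ i * (1 + X (z - d) $ i) - tau_A)\<^sup>2
          + (MuR (z - d) $ i * (1 - X (z - d) $ i) - tau_A)\<^sup>2
          \<le> tau_A\<^sup>2 * ((X d $ i / (1 + x $ i))\<^sup>2 + (X d $ i / (1 - x $ i))\<^sup>2)"
        by (simp add: distrib_left s_def t_def)
    qed
    also have "\<dots> = tau_A\<^sup>2 * local_sq x (X d)" by (simp add: local_sq_def sum_distrib_left)
    also have "\<dots> \<le> tau_A\<^sup>2 * (1 / 32)" using ls by (intro mult_left_mono) auto
    also have "\<dots> \<le> (theta * tau_A)\<^sup>2" by (simp add: theta_def power2_eq_square)
    finally show ?thesis .
  qed
  ultimately have "path_point tau_A (z - d)" by (simp add: path_point_def)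
  then show ?thesis using init x(3,4) by auto
qed

lemma sigma_power_M: "sigma ^ M * tau_A \<le> tau_E"
proof -
  have s: "0 < sigma" "sigma < 1" using sigma_bounds by auto
  have "(ln tau_E - ln tau_A) / ln sigma \<le> real M"
    unfolding M_def by linarith
  then have "real M * ln sigma \<le> ln tau_E - ln tau_A"
    using s by (simp add: divide_le_eq)
  then have "ln (sigma ^ M * tau_A) \<le> ln tau_E"
    using s tau_A_pos by (simp add: ln_mult ln_realpow)
  then show ?thesis using s tau_A_pos tau_E_pos by simp
qed

lemma algorithm_Some:
  obtains z it ds \<tau> where "algorithm = Some (X z, it, ds)" "path_point \<tau> z" "0 < \<tau>" "\<tau> \<le> tau_E"
    "it \<le> K + M" "length ds \<le> K + 1 + 3 * M" "\<forall>d\<in>set ds. d \<le> N"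
proof -
  obtain z ds where z: "initialization = Some (z, ds)" "path_point tau_A z" "length ds = K + 1" "\<forall>d\<in>set ds. d \<le> N"
    using initialization_Some by blast
  obtain z' it' ds' \<tau>' where "path_following M tau_A z K ds = Some (z', it', ds')" "path_point \<tau>' z'" "0 < \<tau>'"
    "\<tau>' \<le> tau_E \<or> \<tau>' = sigma ^ M * tau_A" "it' \<le> K + M" "length ds' \<le> length ds + 3 * M"
    "set ds' \<subseteq> insert N (set ds)"
    using path_following_Some[OF z(2) tau_A_pos, of M K ds] by blast
  then show thesis
    using z sigma_power_M by (intro that[of z' it' ds' \<tau>']) (auto simp: algorithm_def X_def)
qed

section \<open>Accuracy of points close to the central path\<close>

lemma Omega_subset_closure: "x \<in> Omega n \<Longrightarrow> x \<in> Omega_closure n"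
  by (simp add: Omega_def Omega_closure_def)

lemma quad_obj_bound:
  assumes y: "y \<in> Omega_closure n"
  shows "\<bar>quad_obj Q c y\<bar> \<le> C_q"
proof -
  have yc: "y \<in> carrier_vec n" using y by (simp add: Omega_closure_def)
  have ny: "norm2 y \<le> sqrt (real n)" using y n_pos by (rule norm2_Omega_closure[rotated])
  have sQ: "0 \<le> spectral_norm Q" by (rule spectral_norm_nonneg[OF Q n_pos])
  have "\<bar>y \<bullet> (Q *\<^sub>v y)\<bar> \<le> norm2 y * norm2 (Q *\<^sub>v y)"
    using yc Q by (intro scalar_prod_le_norm2[of _ n]) auto
  also have "\<dots> \<le> norm2 y * (spectral_norm Q * norm2 y)"
    using norm2_mult_le_spectral[OF Q yc] by (intro mult_left_mono) auto
  also have "\<dots> = spectral_norm Q * (norm2 y)\<^sup>2" by (simp add: power2_eq_square)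
  also have "\<dots> \<le> spectral_norm Q * (sqrt (real n))\<^sup>2"
    using ny sQ by (intro mult_left_mono power_mono) auto
  finally have 1: "\<bar>y \<bullet> (Q *\<^sub>v y)\<bar> \<le> spectral_norm Q * real n" by simp
  have "\<bar>c \<bullet> y\<bar> \<le> norm2 c * norm2 y" by (rule scalar_prod_le_norm2[OF c yc])
  also have "\<dots> \<le> norm2 c * sqrt (real n)" using ny by (intro mult_left_mono) auto
  finally have 2: "\<bar>c \<bullet> y\<bar> \<le> norm2 c * sqrt (real n)" .
  show ?thesis using 1 2 sQ unfolding quad_obj_def C_q_def by (simp add: abs_le_iff)
qed

text \<open>
  On the neighbourhood of the central path \<open>\<nabla>\<phi>(x) = \<mu>\<^sub>L - \<mu>\<^sub>R\<close>, so convexity bounds \<open>\<phi>(x) - \<phi>(y)\<close> by the sum of the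
  \<open>2 n\<close> complementarity products, each of which is at most \<open>1.3 \<tau>\<close>.
\<close>

lemma phi_gap:
  assumes pz: "path_point \<tau> z" and tau: "0 < \<tau>" and y: "y \<in> Omega_closure n"
  shows "phi (X z) \<le> phi y + 26 / 10 * real n * \<tau>"
proof -
  have z: "interior_point z" "F1 z = 0\<^sub>v n" "F2 z = 0\<^sub>v m" "comp_res \<tau> z \<le> (theta * \<tau>)\<^sup>2"
    using pz by (auto simp: path_point_def)
  have yc: "y \<in> carrier_vec n" and yb: "\<And>i. i < n \<Longrightarrow> -1 \<le> y $ i \<and> y $ i \<le> 1"
    using y n_pos by (auto simp: Omega_closure_iff)
  define u where "u = y - X z"
  have u: "u \<in> carrier_vec n" using yc by (simp add: u_def)
  have "Lam z = (- (1 / omega)) \<cdot>\<^sub>v (A *\<^sub>v X z - b)"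
  proof (rule eq_vecI)
    fix j
    assume "j < dim_vec (- (1 / omega) \<cdot>\<^sub>v (A *\<^sub>v X z - b))"
    then have "j < m" using b by simp
    then show "Lam z $ j = (- (1 / omega) \<cdot>\<^sub>v (A *\<^sub>v X z - b)) $ j"
      using arg_cong[OF z(3), of "\<lambda>v. v $ j"] A b omega_pos by (simp add: F2_def field_simps)
  qed (use b in simp)
  then have "transpose_mat A *\<^sub>v Lam z = (- (1 / omega)) \<cdot>\<^sub>v (transpose_mat A *\<^sub>v (A *\<^sub>v X z - b))"
    using A b by (simp add: mult_mat_vec[of _ n m])
  then have grad: "grad_phi (X z) $ i = MuL z $ i - MuR z $ i" if "i < n" for i
    using arg_cong[OF z(2), of "\<lambda>v. v $ i"] that Q A b c by (simp add: F1_def grad_phi_def)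
  have "- (26 / 10 * real n * \<tau>) = (\<Sum>i<n. - (26 / 10 * \<tau>))" by simp
  also have "\<dots> \<le> (\<Sum>i<n. u $ i * grad_phi (X z) $ i)"
  proof (rule sum_mono)
    fix i
    assume "i \<in> {..<n}"
    then have i: "i < n" by simp
    have "u $ i * grad_phi (X z) $ i = MuL z $ i * (1 + y $ i) - MuL z $ i * (1 + X z $ i)
        + MuR z $ i * (1 - y $ i) - MuR z $ i * (1 - X z $ i)"
      using i yc by (simp add: grad u_def algebra_simps)
    moreover have "0 \<le> MuL z $ i * (1 + y $ i)" "0 \<le> MuR z $ i * (1 - y $ i)"
      using interior_pos[OF z(1) i] yb[OF i] by (auto intro!: mult_nonneg_nonneg)
    ultimately show "- (26 / 10 * \<tau>) \<le> u $ i * grad_phi (X z) $ i"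
      using comp_products(3,4)[OF z(4) tau i] by linarith
  qed
  also have "\<dots> = u \<bullet> grad_phi (X z)" by (intro scalar_prod_sum[symmetric]) simp
  finally have lin: "- (26 / 10 * real n * \<tau>) \<le> u \<bullet> grad_phi (X z)" .
  have "X z + 1 \<cdot>\<^sub>v u = y" using yc by (auto simp: u_def)
  then have "phi y = phi (X z) + u \<bullet> grad_phi (X z) + (u \<bullet> G u) / 2"
    using phi_line[of "X z" u 1] u by simp
  then show ?thesis using lin scalar_prod_G_nonneg[OF u] by linarith
qed

lemma gap_at_tau_E:
  assumes "0 < \<tau>" "\<tau> \<le> tau_E"
  shows "26 / 10 * real n * \<tau> \<le> 6 / 100 * (tol\<^sup>2 * omega / (max (spectral_norm A) C_q)\<^sup>2)"
proof -
  have "26 / 10 * real n * \<tau> \<le> 26 / 10 * real n * tau_E" using assms by (intro mult_left_mono) auto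
  also have "\<dots> = 26 / 480 * (tol\<^sup>2 * omega / (max (spectral_norm A) C_q)\<^sup>2)"
    using n_pos by (simp add: tau_E_def)
  also have "\<dots> \<le> 6 / 100 * (tol\<^sup>2 * omega / (max (spectral_norm A) C_q)\<^sup>2)"
    using omega_pos by (intro mult_right_mono) auto
  finally show ?thesis .
qed

lemma omega_n_le: "omega * real n \<le> tol / 2"
  using omega_le(1) n_pos by (simp add: field_simps)

lemma min_residual_le: "y \<in> Omega_closure n \<Longrightarrow> min_residual n A b \<le> norm2 (A *\<^sub>v y - b)"
  unfolding min_residual_def by (intro cINF_lower bdd_belowI2[of _ 0]) auto

lemma norm2_sq_Omega_closure: "y \<in> Omega_closure n \<Longrightarrow> (norm2 y)\<^sup>2 \<le> real n"
  using power_mono[OF norm2_Omega_closure[OF n_pos, of y] norm2_nonneg, of 2] by simp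

text \<open>
  If \<open>C_q \<le> tol / 2\<close>, the oscillation of \<open>q\<close> on the box is at most \<open>tol\<close>. Otherwise the denominator of \<open>tau_E\<close> is bounded
  below and the gap of \<open>phi_gap\<close> is small.
\<close>

lemma objective_accuracy:
  assumes pz: "path_point \<tau> z" and tau: "0 < \<tau>" "\<tau> \<le> tau_E"
    and y: "y \<in> Omega_closure n" and ymin: "norm2 (A *\<^sub>v y - b) = min_residual n A b"
  shows "quad_obj Q c (X z) \<le> quad_obj Q c y + tol"
proof (cases "C_q \<le> tol / 2")
  case True
  have xO: "X z \<in> Omega_closure n"
    using pz by (auto simp: path_point_def interior_point_def Omega_subset_closure)
  show ?thesis using quad_obj_bound[OF xO] quad_obj_bound[OF y] True by linarith
next
  case False
  have xO: "X z \<in> Omega_closure n"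
    using pz by (auto simp: path_point_def interior_point_def Omega_subset_closure)
  let ?M = "max (spectral_norm A) C_q"
  have M: "tol / 2 \<le> ?M" using False by simp
  have "tol\<^sup>2 / ?M\<^sup>2 = (tol / ?M)\<^sup>2" by (simp add: power_divide)
  also have "\<dots> \<le> 2\<^sup>2" using M tol_pos by (intro power_mono) (auto simp: divide_le_eq)
  finally have "omega * (tol\<^sup>2 / ?M\<^sup>2) \<le> omega * 4" using omega_pos by (intro mult_left_mono) auto
  moreover have "omega \<le> omega * real n" using omega_pos n_pos by simp
  ultimately have gap: "26 / 10 * real n * \<tau> \<le> tol / 4"
    using gap_at_tau_E[OF tau] omega_n_le tol_pos by (simp add: mult.commute)
  have "(min_residual n A b)\<^sup>2 \<le> (norm2 (A *\<^sub>v X z - b))\<^sup>2"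
    using min_residual_le[OF xO] ymin norm2_nonneg[of "A *\<^sub>v y - b"] by (intro power_mono) auto
  then have "1 / (2 * omega) * (norm2 (A *\<^sub>v y - b))\<^sup>2 \<le> 1 / (2 * omega) * (norm2 (A *\<^sub>v X z - b))\<^sup>2"
    using omega_pos by (intro mult_left_mono) (auto simp: ymin)
  moreover have "omega / 2 * (norm2 y)\<^sup>2 \<le> omega / 2 * real n"
    using norm2_sq_Omega_closure[OF y] omega_pos by (intro mult_left_mono) auto
  moreover have "0 \<le> omega / 2 * (norm2 (X z))\<^sup>2" using omega_pos by simp
  ultimately show ?thesis
    using phi_gap[OF pz tau(1) y] gap omega_n_le tol_pos unfolding phi_def by linarith
qed

text \<open>
  If the maximum in the definition of \<open>tau_E\<close> is below \<open>tol / (2 n)\<close>, so is \<open>\<parallel>A\<parallel>\<close>, and the residual varies by at most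
  \<open>tol\<close> on the box. Otherwise that maximum is at least \<open>\<omega>\<close>, and the gap of \<open>phi_gap\<close>, which enters the comparison
  of squared residuals with the factor \<open>2 \<omega>\<close>, contributes only a fraction of \<open>tol\<^sup>2\<close>.
\<close>

lemma residual_accuracy:
  assumes pz: "path_point \<tau> z" and tau: "0 < \<tau>" "\<tau> \<le> tau_E"
  shows "norm2 (A *\<^sub>v X z - b) \<le> min_residual n A b + tol"
proof -
  let ?x = "X z"
  have xO: "?x \<in> Omega_closure n"
    using pz by (auto simp: path_point_def interior_point_def Omega_subset_closure)
  have "norm2 (A *\<^sub>v ?x - b) \<le> norm2 (A *\<^sub>v y - b) + tol" if y: "y \<in> Omega_closure n" for y
  proof (cases "max (spectral_norm A) C_q < tol / (2 * real n)")
    case True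
    have yc: "y \<in> carrier_vec n" using y by (simp add: Omega_closure_def)
    have "A *\<^sub>v ?x - b = (A *\<^sub>v y - b) + A *\<^sub>v (?x - y)"
      using A b yc by (intro eq_vecI) (simp_all add: mult_minus_distrib_mat_vec[of _ m n])
    then have "norm2 (A *\<^sub>v ?x - b) \<le> norm2 (A *\<^sub>v y - b) + norm2 (A *\<^sub>v (?x - y))"
      using norm2_triangle[of "A *\<^sub>v y - b" m "A *\<^sub>v (?x - y)"] A b yc by simp
    also have "norm2 (A *\<^sub>v (?x - y)) \<le> spectral_norm A * norm2 (?x - y)"
      using yc by (intro norm2_mult_le_spectral[OF A]) auto
    also have "\<dots> \<le> tol / (2 * real n) * (2 * sqrt (real n))"
    proof (intro mult_mono)
      show "norm2 (?x - y) \<le> 2 * sqrt (real n)"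
        using norm2_triangle_minus[OF block_carrier(1) yc, of z] norm2_Omega_closure[OF n_pos xO]
          norm2_Omega_closure[OF n_pos y] by linarith
    qed (use True tol_pos in auto)
    also have "\<dots> \<le> tol / (2 * real n) * (2 * real n)"
    proof (rule mult_left_mono)
      have "1 \<le> real n" using n_pos by simp
      then have "real n \<le> real n * real n" using mult_left_mono[of 1 "real n" "real n"] by simp
      then have "sqrt (real n) \<le> real n" by (intro real_le_lsqrt) (auto simp: power2_eq_square)
      then show "2 * sqrt (real n) \<le> 2 * real n" by simp
    qed (use tol_pos in auto)
    also have "\<dots> = tol" using n_pos by simp
    finally show ?thesis by simp
  next
    case False
    let ?M = "max (spectral_norm A) C_q"
    have "omega \<le> ?M" using False omega_le(1) by linarith
    then have "(omega / ?M)\<^sup>2 \<le> 1\<^sup>2" using omega_pos max_norm_pos by (intro power_mono) auto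
    then have "tol\<^sup>2 * (omega / ?M)\<^sup>2 \<le> tol\<^sup>2 * 1" by (intro mult_left_mono) auto
    moreover have "omega * (6 / 100 * (tol\<^sup>2 * omega / ?M\<^sup>2)) = 6 / 100 * (tol\<^sup>2 * (omega / ?M)\<^sup>2)"
      by (simp add: power2_eq_square)
    moreover have "omega * (26 / 10 * real n * \<tau>) \<le> omega * (6 / 100 * (tol\<^sup>2 * omega / ?M\<^sup>2))"
      using gap_at_tau_E[OF tau] omega_pos by (intro mult_left_mono) auto
    ultimately have gap: "omega * (26 / 10 * real n * \<tau>) \<le> 6 / 100 * tol\<^sup>2" by linarith
    have w: "omega * (4 * C_q + real n) \<le> tol\<^sup>2 / 16"
    proof -
      have "omega * (4 * C_q + real n) \<le> tol\<^sup>2 / (16 * (4 * C_q + real n)) * (4 * C_q + real n)"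
        using omega_le(2) C_q_nonneg by (intro mult_right_mono) auto
      also have "\<dots> = tol\<^sup>2 / 16"
      proof -
        have "tol\<^sup>2 / (16 * v) * v = tol\<^sup>2 / 16" if "0 < v" for v :: real using that by simp
        moreover have "0 < 4 * C_q + real n" using C_q_nonneg n_pos by simp
        ultimately show ?thesis by blast
      qed
      finally show ?thesis .
    qed
    have "phi ?x \<le> phi y + 26 / 10 * real n * \<tau>" by (rule phi_gap[OF pz tau(1) y])
    moreover have "quad_obj Q c y \<le> C_q" "- C_q \<le> quad_obj Q c ?x"
      using quad_obj_bound[OF y] quad_obj_bound[OF xO] by linarith+
    moreover have "omega / 2 * (norm2 y)\<^sup>2 \<le> 1 / 2 * real n"
      using norm2_sq_Omega_closure[OF y] omega_le(3) omega_pos by (intro mult_mono) auto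
    moreover have "0 \<le> omega / 2 * (norm2 ?x)\<^sup>2" using omega_pos by simp
    ultimately have "1 / (2 * omega) * (norm2 (A *\<^sub>v ?x - b))\<^sup>2 \<le>
        1 / (2 * omega) * (norm2 (A *\<^sub>v y - b))\<^sup>2 + (2 * C_q + 1 / 2 * real n + 26 / 10 * real n * \<tau>)"
      unfolding phi_def by linarith
    then have "2 * omega * (1 / (2 * omega) * (norm2 (A *\<^sub>v ?x - b))\<^sup>2) \<le>
        2 * omega * (1 / (2 * omega) * (norm2 (A *\<^sub>v y - b))\<^sup>2 + (2 * C_q + 1 / 2 * real n + 26 / 10 * real n * \<tau>))"
      using omega_pos by (intro mult_left_mono) auto
    then have "(norm2 (A *\<^sub>v ?x - b))\<^sup>2 \<le> (norm2 (A *\<^sub>v y - b))\<^sup>2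
        + omega * (4 * C_q + real n) + 2 * (omega * (26 / 10 * real n * \<tau>))"
      using omega_pos by (simp add: distrib_left algebra_simps)
    also have "\<dots> \<le> (norm2 (A *\<^sub>v y - b))\<^sup>2 + tol\<^sup>2 + 2 * norm2 (A *\<^sub>v y - b) * tol"
    proof -
      have "0 \<le> 2 * norm2 (A *\<^sub>v y - b) * tol" using tol_pos by simp
      then show ?thesis using w gap zero_le_power2[of tol] by linarith
    qed
    also have "\<dots> = (norm2 (A *\<^sub>v y - b) + tol)\<^sup>2" by (simp add: power2_sum)
    finally show ?thesis by (rule power2_le_imp_le) (use tol_pos in simp)
  qed
  then have "norm2 (A *\<^sub>v ?x - b) - tol \<le> min_residual n A b"
    unfolding min_residual_def using xO by (intro cINF_greatest) (auto simp: diff_le_eq)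
  then show ?thesis by simp
qed

section \<open>Bounds for the iteration counts\<close>

text \<open>
  The number whose logarithm is \<open>L\<close>.
\<close>

definition data_size :: real where
  "data_size = (1 + spectral_norm Q + norm2 c + spectral_norm A + norm2 b) * real (n + m) / tol"

text \<open>
  Bounds by a fixed power of \<^term>\<open>data_size\<close>. Because \<^term>\<open>data_size\<close> is at least 2, constant factors are
  absorbed into the exponent, so a bound for a parameter is found by composing the rules below along its
  defining expression. The exponents are not optimized.
\<close>

definition poly_le :: "nat \<Rightarrow> real \<Rightarrow> bool" where
  "poly_le k x \<longleftrightarrow> 0 \<le> x \<and> x \<le> data_size ^ k"

lemma norms_nonneg: "0 \<le> spectral_norm Q" "0 \<le> spectral_norm A"
  using spectral_norm_nonneg[OF Q n_pos] spectral_norm_nonneg[OF A n_pos] by auto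

lemma L_eq: "L = ln data_size"
proof -
  have "0 < 1 + spectral_norm Q + norm2 c + spectral_norm A + norm2 b"
    using norms_nonneg norm2_nonneg[of c] norm2_nonneg[of b] by linarith
  then show ?thesis
    using n_pos tol_pos unfolding L_def data_size_def by (subst ln_div) (auto simp: ln_mult)
qed

lemma data_size_ge:
  assumes "x \<le> 1 + spectral_norm Q + norm2 c + spectral_norm A + norm2 b"
    and "y \<le> real (n + m)" "w \<le> 1 / tol" "0 \<le> x" "0 \<le> y" "0 \<le> w"
  shows "x * y * w \<le> data_size"
proof -
  have "x * y * w \<le> (1 + spectral_norm Q + norm2 c + spectral_norm A + norm2 b) * real (n + m) * (1 / tol)"
    using assms by (intro mult_mono mult_nonneg_nonneg) auto
  then show ?thesis by (simp add: data_size_def)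
qed

lemma data_size_ge_2: "2 \<le> data_size"
  using data_size_ge[of 1 2 1] norms_nonneg n_pos m_pos tol_pos tol_less_1 norm2_nonneg[of c] norm2_nonneg[of b]
  by simp

lemma poly_le_mono:
  assumes "poly_le k x" "k \<le> l"
  shows "poly_le l x"
proof -
  have "data_size ^ k \<le> data_size ^ l" using assms(2) data_size_ge_2 by (intro power_increasing) auto
  with assms(1) show ?thesis by (simp add: poly_le_def)
qed

lemma poly_le_mult: "poly_le k x \<Longrightarrow> poly_le l y \<Longrightarrow> poly_le (k + l) (x * y)"
  using data_size_ge_2 by (auto simp: poly_le_def power_add intro!: mult_mono)

lemma poly_le_power2: "poly_le k x \<Longrightarrow> poly_le (k + k) (x\<^sup>2)"
  unfolding power2_eq_square by (rule poly_le_mult)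

lemma poly_le_add: 
  assumes "poly_le k x" "poly_le l y"
  shows "poly_le (Suc (max k l)) (x + y)"
proof -
  have "poly_le (max k l) x" "poly_le (max k l) y" using assms by (auto intro: poly_le_mono)
  then have "x + y \<le> 2 * data_size ^ max k l" "0 \<le> x + y" by (auto simp: poly_le_def)
  moreover have "2 * data_size ^ max k l \<le> data_size * data_size ^ max k l"
    using data_size_ge_2 by (intro mult_right_mono) auto
  ultimately show ?thesis by (simp add: poly_le_def)
qed

lemma poly_le_max: "poly_le k x \<Longrightarrow> poly_le l y \<Longrightarrow> poly_le (max k l) (max x y)"
  using poly_le_mono[of k x "max k l"] poly_le_mono[of l y "max k l"] by (auto simp: poly_le_def max_def)

lemma poly_le_sqrt: "poly_le k x \<Longrightarrow> poly_le k (sqrt x)"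
proof -
  assume *: "poly_le k x"
  have "1 \<le> data_size ^ k" using data_size_ge_2 by simp
  then have "data_size ^ k \<le> (data_size ^ k)\<^sup>2" using mult_left_mono[of 1 "data_size ^ k" "data_size ^ k"] by (simp add: power2_eq_square)
  with * show ?thesis by (auto simp: poly_le_def intro!: real_le_lsqrt)
qed

lemma poly_le_const:
  assumes "0 \<le> x" "x \<le> 2 ^ k"
  shows "poly_le k x"
proof -
  have "2 ^ k \<le> data_size ^ k" using data_size_ge_2 by (intro power_mono) auto
  with assms show ?thesis by (simp add: poly_le_def)
qed

lemma poly_le_numerals:
  "poly_le 1 1" "poly_le 1 2" "poly_le 2 3" "poly_le 2 4" "poly_le 3 8" "poly_le 4 10" "poly_le 4 16" "poly_le 6 48"
  by (auto intro!: poly_le_const)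

lemma poly_le_data:
  "poly_le 1 (spectral_norm Q)" "poly_le 1 (spectral_norm A)" "poly_le 1 (norm2 c)" "poly_le 1 (norm2 b)"
  "poly_le 1 (real n)" "poly_le 1 (real m)" "poly_le 1 (1 / tol)"
  using data_size_ge[of "spectral_norm Q" 1 1] data_size_ge[of "spectral_norm A" 1 1] data_size_ge[of "norm2 c" 1 1]
    data_size_ge[of "norm2 b" 1 1] data_size_ge[of 1 "real n" 1] data_size_ge[of 1 "real m" 1] data_size_ge[of 1 1 "1 / tol"]
    norms_nonneg n_pos m_pos tol_pos tol_less_1 norm2_nonneg[of c] norm2_nonneg[of b]
  by (simp_all add: poly_le_def)

lemmas poly_le_rules = poly_le_numerals poly_le_data poly_le_mult poly_le_add poly_le_max poly_le_sqrt poly_le_power2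

lemma poly_le_C_q: "poly_le 3 C_q"
  unfolding C_q_def by (rule poly_le_mono, (rule poly_le_rules)+, simp)

text \<open>
  The positive numbers whose reciprocal is bounded in this way.
\<close>

definition recip_le :: "nat \<Rightarrow> real \<Rightarrow> bool" where
  "recip_le k x \<longleftrightarrow> 0 < x \<and> poly_le k (1 / x)"

lemma recip_le_min: "recip_le k x \<Longrightarrow> recip_le l y \<Longrightarrow> recip_le (max k l) (min x y)"
  using poly_le_mono[of k "1 / x" "max k l"] poly_le_mono[of l "1 / y" "max k l"] by (auto simp: recip_le_def min_def)

lemma poly_le_omega: "poly_le 1 omega" "poly_le 13 (1 / omega)"
proof -
  show "poly_le 1 omega" using omega_pos omega_le(3) by (intro poly_le_const) auto
  have "recip_le 3 (tol / (2 * real n))"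
  proof -
    have "poly_le 3 (2 * real n * (1 / tol))" by (rule poly_le_mono, (rule poly_le_rules)+, simp)
    then show ?thesis using tol_pos n_pos by (simp add: recip_le_def)
  qed
  moreover have "recip_le 13 (tol\<^sup>2 / (16 * (4 * C_q + real n)))"
  proof -
    have "poly_le 13 (16 * (4 * C_q + real n) * (1 / tol)\<^sup>2)"
      by (rule poly_le_mono, (rule poly_le_rules poly_le_C_q)+, simp)
    then show ?thesis
      using tol_pos n_pos C_q_nonneg by (simp add: recip_le_def power_divide)
  qed
  moreover have "recip_le 1 1" using poly_le_numerals(1) by (simp add: recip_le_def)
  ultimately have "recip_le (max 3 (max 13 1)) (min (tol / (2 * real n)) (min (tol\<^sup>2 / (16 * (4 * C_q + real n))) 1))"
    by (intro recip_le_min)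
  then show "poly_le 13 (1 / omega)" by (simp add: recip_le_def omega_def)
qed

lemma poly_le_C_lambda: "poly_le 16 C_lambda"
proof -
  have "poly_le 16 ((spectral_norm A * sqrt (real n) + norm2 b) * (1 / omega))"
    by (rule poly_le_mono, (rule poly_le_rules poly_le_omega)+, simp)
  then show ?thesis by (simp add: C_lambda_def)
qed

lemma poly_le_C_Dmu: "poly_le 18 C_Dmu"
  unfolding C_Dmu_def by (rule poly_le_mono, (rule poly_le_rules poly_le_omega poly_le_C_lambda)+, simp)

lemma tau_A_le:
  "tau_A \<le> max (spectral_norm Q + omega + 1 / omega * (spectral_norm A)\<^sup>2)
     (4 * (norm2 c + 1 / omega * (spectral_norm A * norm2 b)))"
proof -
  let ?G = "Q + omega \<cdot>\<^sub>m 1\<^sub>m n + (1 / omega) \<cdot>\<^sub>m (transpose_mat A * A)"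
  let ?C = "spectral_norm Q + omega + 1 / omega * (spectral_norm A)\<^sup>2"
  have C0: "0 \<le> ?C" using norms_nonneg omega_pos by simp
  have "spectral_norm ?G \<le> ?C"
  proof (rule spectral_norm_le[of _ n n])
    show "?G \<in> carrier_mat n n" using Q A by simp
    show "0 \<le> ?C" by (rule C0)
    fix v :: "real vec"
    assume v: "v \<in> carrier_vec n"
    have "?G *\<^sub>v v = G v"
      using Q A v by (intro eq_vecI) (simp_all add: G_def add.assoc add_mult_distrib_mat_vec[of _ n n] smult_mat_mult_vec[of _ n n])
    also have "norm2 (G v) \<le> norm2 (Q *\<^sub>v v + omega \<cdot>\<^sub>v v) + norm2 ((1 / omega) \<cdot>\<^sub>v (transpose_mat A *\<^sub>v (A *\<^sub>v v)))"
      unfolding G_def using Q A v by (intro norm2_triangle[of _ n]) auto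
    also have "norm2 (Q *\<^sub>v v + omega \<cdot>\<^sub>v v) \<le> norm2 (Q *\<^sub>v v) + norm2 (omega \<cdot>\<^sub>v v)"
      using Q v by (intro norm2_triangle[of _ n]) auto
    also have "\<dots> \<le> spectral_norm Q * norm2 v + omega * norm2 v"
      using norm2_mult_le_spectral[OF Q v] omega_pos by (simp add: norm2_smult)
    also have "norm2 ((1 / omega) \<cdot>\<^sub>v (transpose_mat A *\<^sub>v (A *\<^sub>v v))) \<le> 1 / omega * (spectral_norm A * (spectral_norm A * norm2 v))"
    proof -
      have "norm2 (transpose_mat A *\<^sub>v (A *\<^sub>v v)) \<le> spectral_norm A * norm2 (A *\<^sub>v v)"
        using A v by (intro norm2_transpose_mult_le[OF A n_pos]) auto
      also have "\<dots> \<le> spectral_norm A * (spectral_norm A * norm2 v)"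
        using norm2_mult_le_spectral[OF A v] norms_nonneg by (intro mult_left_mono) auto
      finally show ?thesis using omega_pos by (simp add: norm2_smult divide_right_mono)
    qed
    finally show "norm2 (?G *\<^sub>v v) \<le> ?C * norm2 v"
      by (simp add: algebra_simps power2_eq_square)
  qed
  then have 1: "1 / 4 * spectral_norm ?G \<le> ?C" using C0 by linarith
  have "norm2 (c - (1 / omega) \<cdot>\<^sub>v (transpose_mat A *\<^sub>v b)) \<le> norm2 c + norm2 ((1 / omega) \<cdot>\<^sub>v (transpose_mat A *\<^sub>v b))"
    using A b c by (intro norm2_triangle_minus[of _ n]) auto
  also have "norm2 ((1 / omega) \<cdot>\<^sub>v (transpose_mat A *\<^sub>v b)) \<le> 1 / omega * (spectral_norm A * norm2 b)"
    using norm2_transpose_mult_le[OF A n_pos b] omega_pos by (simp add: norm2_smult divide_right_mono)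
  finally have 2: "4 * norm2 (c - (1 / omega) \<cdot>\<^sub>v (transpose_mat A *\<^sub>v b))
      \<le> 4 * (norm2 c + 1 / omega * (spectral_norm A * norm2 b))" by simp
  show ?thesis unfolding tau_A_def using 1 2 by (intro max.mono)
qed

lemma poly_le_tau_A: "poly_le 18 tau_A"
proof -
  have "poly_le 18 (max (spectral_norm Q + omega + 1 / omega * (spectral_norm A)\<^sup>2)
     (4 * (norm2 c + 1 / omega * (spectral_norm A * norm2 b))))"
    by (rule poly_le_mono, (rule poly_le_rules poly_le_omega)+, simp)
  then show ?thesis
    using order_trans[OF tau_A_le] tau_A_pos unfolding poly_le_def by (simp only: less_imp_le simp_thms)
qed

lemma poly_le_tau_E: "poly_le 28 (1 / tau_E)"
proof -
  have "poly_le 28 (48 * real n * (max (spectral_norm A) C_q)\<^sup>2 * ((1 / tol)\<^sup>2 * (1 / omega)))"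
    by (rule poly_le_mono, (rule poly_le_rules poly_le_omega poly_le_C_q)+, simp)
  then show ?thesis by (simp add: tau_E_def power_divide)
qed

lemma poly_le_C_mu: "poly_le 23 C_mu"
proof -
  have "poly_le 1 (1 + theta)" by (rule poly_le_const) (simp_all add: theta_def)
  then have "poly_le 23 (sqrt (2 * real n) * (C_Dmu + (1 + theta) * tau_A))"
    by - (rule poly_le_mono, (assumption | rule poly_le_rules poly_le_tau_A poly_le_C_Dmu)+, simp)
  then show ?thesis by (simp add: C_mu_def)
qed

lemma poly_le_C_z: "poly_le 49 C_z"
proof -
  have "poly_le 1 (1 / 10)" by (rule poly_le_const) simp_all
  then have "poly_le 49 (sqrt (real n + C_lambda\<^sup>2 + C_mu\<^sup>2) + 1 / 10)"
    by - (rule poly_le_mono, (assumption | rule poly_le_rules poly_le_C_lambda poly_le_C_mu)+, simp)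
  then show ?thesis by (simp add: C_z_def)
qed

lemma C_z_nonneg: "0 \<le> C_z"
  using poly_le_C_z by (simp add: poly_le_def)

lemma recip_le_c_gap: "recip_le 82 c_gap"
proof -
  have s: "0 < sigma" using sigma_bounds by simp
  have "poly_le 1 (1 / (1 - theta))" "poly_le 2 (2 / sigma)"
    using sigma_bounds by (auto intro!: poly_le_const simp: theta_def divide_le_eq)
  then have "poly_le 82 ((1 + C_z) * (1 / (1 - theta)) * (2 / sigma) * (1 / tau_E))"
    by - (rule poly_le_mono, (assumption | rule poly_le_rules poly_le_C_z poly_le_tau_E)+, simp)
  moreover have "1 / c_gap = (1 + C_z) * (1 / (1 - theta)) * (2 / sigma) * (1 / tau_E)"
    by (simp add: c_gap_def)
  moreover have "0 < c_gap"
    unfolding c_gap_def using s tau_E_pos C_z_nonneg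
    by (intro mult_pos_pos divide_pos_pos) (auto simp: theta_def)
  ultimately show ?thesis by (simp add: recip_le_def)
qed

lemma poly_le_C_DF: "poly_le 55 C_DF"
proof -
  have "frobenius_norm A \<le> sqrt (real n) * spectral_norm A" by (rule frobenius_le_spectral[OF A])
  moreover have "poly_le 2 (sqrt (real n) * spectral_norm A)"
    by (rule poly_le_mono, (rule poly_le_rules)+, simp)
  ultimately have "poly_le 2 (frobenius_norm A)" using frobenius_norm_nonneg[of A] by (simp add: poly_le_def)
  then show ?thesis
    unfolding C_DF_def
    by - (rule poly_le_mono, (assumption | rule poly_le_rules poly_le_omega poly_le_C_z)+, simp)
qed

lemma C_DF_pos: "0 < C_DF"
  unfolding C_DF_def using norms_nonneg omega_pos frobenius_norm_nonneg[of A] C_z_nonneg by linarith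

lemma poly_le_C_DFinv: "poly_le 213 C_DFinv"
proof -
  have "poly_le 82 (1 / c_gap)" using recip_le_c_gap by (simp add: recip_le_def)
  then have "poly_le 213 (1 / c_gap * max (1 / omega) (C_z * (1 / c_gap)))"
    by - (rule poly_le_mono, (assumption | rule poly_le_rules poly_le_omega poly_le_C_z)+, simp)
  then show ?thesis by (simp add: C_DFinv_def)
qed

lemma C_DFinv_pos: "0 < C_DFinv"
  unfolding C_DFinv_def using recip_le_c_gap omega_pos by (auto simp: recip_le_def less_max_iff_disj intro!: mult_pos_pos)

lemma poly_le_kappa: "poly_le 268 kappa_DF"
  unfolding kappa_DF_def
  by (rule poly_le_mono, (rule poly_le_rules poly_le_C_DF poly_le_C_DFinv)+, simp)

lemma poly_le_C_nu: "poly_le 540 C_nu"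
proof -
  have "poly_le 540 (max (2 * C_dDz * (C_dF * C_DFinv + 2 * (1 / omega) * C_dDF * C_z)) (1 + C_DFinv * C_dF))"
    unfolding C_dDz_def C_dF_def C_dDF_def
    by (rule poly_le_mono, (rule poly_le_rules poly_le_omega poly_le_kappa poly_le_C_DF poly_le_C_DFinv poly_le_C_z)+, simp)
  then show ?thesis by (simp add: C_nu_def)
qed

lemma C_nu_ge_1: "1 \<le> C_nu"
  unfolding C_nu_def C_dF_def using C_DF_pos C_DFinv_pos by (simp add: le_max_iff_disj)

lemma recip_le_nu2: "recip_le 640 nu2"
proof -
  have cg: "poly_le 82 (1 / c_gap)" "0 < c_gap" using recip_le_c_gap by (auto simp: recip_le_def)
  have kap: "0 < kappa_DF" unfolding kappa_DF_def using C_DF_pos C_DFinv_pos by simp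
  have s: "0 < sigma" "poly_le 3 (1 / (theta * sigma))"
    using sigma_bounds by (auto intro!: poly_le_const simp: theta_def divide_le_eq)
  have "recip_le 4 0.1" using poly_le_numerals(6) by (simp add: recip_le_def)
  moreover have "recip_le 622 (c_gap / C_nu)"
  proof -
    have "poly_le 622 (C_nu * (1 / c_gap))"
      using cg by - (rule poly_le_mono, (assumption | rule poly_le_rules poly_le_C_nu)+, simp)
    then show ?thesis using cg C_nu_ge_1 by (simp add: recip_le_def)
  qed
  moreover have "recip_le 290 (omega / (2 * C_dDF * kappa_DF))"
  proof -
    have "poly_le 290 (2 * C_dDF * kappa_DF * (1 / omega))"
      unfolding C_dDF_def by (rule poly_le_mono, (rule poly_le_rules poly_le_omega poly_le_kappa)+, simp)
    then show ?thesis using omega_pos kap by (simp add: recip_le_def C_dDF_def)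
  qed
  moreover have "recip_le 640 (theta * sigma * tau_E / (2 * C_nu * C_dF))"
  proof -
    have "poly_le 640 (2 * C_nu * C_dF * (1 / (theta * sigma)) * (1 / tau_E))"
      unfolding C_dF_def using s
      by - (rule poly_le_mono, (assumption | rule poly_le_rules poly_le_C_nu poly_le_C_DF poly_le_tau_E)+, simp)
    then show ?thesis
      using s tau_E_pos C_DF_pos C_nu_ge_1 by (simp add: recip_le_def C_dF_def theta_def)
  qed
  ultimately have "recip_le (max 4 (max 622 (max 290 640))) (min 0.1 (min (c_gap / C_nu)
     (min (omega / (2 * C_dDF * kappa_DF)) (theta * sigma * tau_E / (2 * C_nu * C_dF)))))"
    by (intro recip_le_min)
  then show ?thesis by (simp add: nu2_def)
qed

lemma poly_le_rho: "poly_le 680 (C_Hf / rho)" and rho_le: "1 \<le> C_Hf / rho"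
proof -
  let ?D = "spectral_norm A / omega + 1 + 8 * tau_A"
  have nu: "poly_le 640 (1 / nu2)" "0 < nu2" using recip_le_nu2 by (auto simp: recip_le_def)
  have "poly_le 680 (10 * (4 * sqrt (3 * real n + real m) * (spectral_norm A * (1 / omega) + 1 + 8 * tau_A) * (1 / nu2)))"
    using nu by - (rule poly_le_mono, (assumption | rule poly_le_rules poly_le_omega poly_le_tau_A)+, simp)
  then show "poly_le 680 (C_Hf / rho)" by (simp add: rho_def C_Hf_def N_def)
  have D: "1 \<le> ?D" using norms_nonneg omega_pos tau_A_pos by simp
  have N: "1 \<le> sqrt (real N)" using n_pos by (simp add: N_def)
  have nu_le: "nu2 \<le> 1" by (simp add: nu2_def)
  have "nu2 / ?D \<le> 1" using D nu_le by (simp add: divide_le_eq)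
  moreover have "1 / (4 * sqrt (real N)) \<le> 1"
    by (subst divide_le_eq_1_pos; use N in linarith)
  ultimately have "1 / (4 * sqrt (real N)) * (nu2 / ?D) \<le> 1 * 1"
    using D nu by (intro mult_mono) auto
  then have "rho \<le> 1" by (simp add: rho_def)
  moreover have "0 < rho" unfolding rho_def using N D nu by (intro mult_pos_pos divide_pos_pos) auto
  ultimately show "1 \<le> C_Hf / rho" by (simp add: C_Hf_def)
qed

lemma L_ge: "2 / 3 \<le> L"
proof -
  have "ln 2 \<le> ln data_size" using data_size_ge_2 by (intro ln_mono) auto
  then show ?thesis using ln2_ge_two_thirds by (simp add: L_eq)
qed

lemma ln_le_of_poly_le: "poly_le k x \<Longrightarrow> 0 < x \<Longrightarrow> ln x \<le> real k * L"
  using data_size_ge_2 ln_mono[of x "data_size ^ k"] by (simp add: poly_le_def L_eq ln_realpow)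

lemma log2_le: "0 \<le> ln x \<Longrightarrow> log 2 x \<le> 3 / 2 * ln x"
proof -
  assume "0 \<le> ln x"
  then have "ln x / ln 2 \<le> ln x / (2 / 3)" using ln2_ge_two_thirds by (intro divide_left_mono) auto
  then show ?thesis by (simp add: log_def)
qed

lemma nat_ceiling_le: "0 \<le> x \<Longrightarrow> real (nat \<lceil>x\<rceil>) \<le> x + 1"
  by linarith

lemma sqrt_n_ge_1: "1 \<le> sqrt (real n)"
  using n_pos by simp

lemma K_le: "real K \<le> 1532 * L"
proof -
  let ?t = "log 2 (C_Hf / rho)"
  have ln0: "0 \<le> ln (C_Hf / rho)" using rho_le by simp
  then have t0: "0 \<le> ?t" by (simp add: log_def)
  have "?t \<le> 3 / 2 * ln (C_Hf / rho)" by (rule log2_le[OF ln0])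
  also have "\<dots> \<le> 3 / 2 * (680 * L)"
    using ln_le_of_poly_le[OF poly_le_rho] rho_le by (intro mult_left_mono) auto
  finally have t: "?t \<le> 1020 * L" by simp
  have "log 2 (1 + ?t) \<le> 3 / 2 * ln (1 + ?t)" using t0 by (intro log2_le) simp
  also have "\<dots> \<le> 3 / 2 * ?t" using ln_add_one_self_le_self[OF t0] by simp
  finally have "log 2 (1 + ?t) \<le> 1530 * L" using t by simp
  moreover have "0 \<le> log 2 (1 + ?t)" using t0 by (simp add: log_def)
  ultimately have "real K \<le> 1530 * L + 1" unfolding K_def using nat_ceiling_le[of "log 2 (1 + ?t)"] by linarith
  then show ?thesis using L_ge by linarith
qed

lemma M_le: "real M \<le> 232 * L * sqrt (real n)"
proof -
  have s: "0 < sigma" "sigma < 1" using sigma_bounds by auto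
  have ls: "3 / 10 / sqrt (2 * real n) \<le> - ln sigma"
    using ln_le_minus_one[OF s(1)] by (simp add: sigma_def beta_def theta_def)
  have s2: "sqrt (2 * real n) \<le> 3 / 2 * sqrt (real n)"
    by (rule real_le_lsqrt) (auto simp: power_mult_distrib power2_eq_square)
  have num: "0 \<le> ln tau_A - ln tau_E" using tau_less tau_E_pos by simp
  have "ln tau_A \<le> 18 * L" using ln_le_of_poly_le[OF poly_le_tau_A tau_A_pos] by simp
  moreover have "- ln tau_E \<le> 28 * L"
    using ln_le_of_poly_le[OF poly_le_tau_E] tau_E_pos by (simp add: ln_div)
  ultimately have numle: "ln tau_A - ln tau_E \<le> 46 * L" by simp
  have "(ln tau_E - ln tau_A) / ln sigma = (ln tau_A - ln tau_E) / (- ln sigma)" by (simp add: minus_divide_left[symmetric] diff_divide_distrib)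
  also have "\<dots> \<le> (ln tau_A - ln tau_E) / (3 / 10 / sqrt (2 * real n))"
  proof (rule divide_left_mono[OF ls num mult_pos_pos])
    show "0 < - ln sigma" using s by simp
    show "0 < 3 / 10 / sqrt (2 * real n)" using n_pos by simp
  qed
  also have "\<dots> = (ln tau_A - ln tau_E) * (10 / 3 * sqrt (2 * real n))" by simp
  also have "\<dots> \<le> 46 * L * (10 / 3 * (3 / 2 * sqrt (real n)))"
    using numle s2 num L_ge by (intro mult_mono mult_left_mono) auto
  finally have "(ln tau_E - ln tau_A) / ln sigma \<le> 230 * L * sqrt (real n)" by simp
  moreover have "0 \<le> (ln tau_E - ln tau_A) / ln sigma"
    using num s by (intro divide_nonpos_nonpos) auto
  ultimately have "real M \<le> 230 * L * sqrt (real n) + 1"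
    unfolding M_def using nat_ceiling_le[of "(ln tau_E - ln tau_A) / ln sigma"] by linarith
  moreover have "2 / 3 * 1 \<le> L * sqrt (real n)" using L_ge sqrt_n_ge_1 by (intro mult_mono) auto
  ultimately show ?thesis by linarith
qed

lemma iteration_bounds:
  "real (K + M) \<le> 3000 * L * sqrt (real n)" "real (K + 1 + 3 * M) \<le> 3000 * L * sqrt (real n)"
proof -
  have "L * 1 \<le> L * sqrt (real n)" using L_ge sqrt_n_ge_1 by (intro mult_left_mono) auto
  then show "real (K + M) \<le> 3000 * L * sqrt (real n)" "real (K + 1 + 3 * M) \<le> 3000 * L * sqrt (real n)"
    using K_le M_le L_ge unfolding of_nat_add of_nat_mult of_nat_1 of_nat_numeral mult.assoc by linarith+
qed

end

section \<open>Correctness and complexity\<close>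

theorem mainTheorem1:
  shows "\<exists>C::real. C > 0 \<and> (\<forall>(n::nat) (m::nat) (Q::real mat) (c::real vec) (A::real mat) (b::real vec) (tol::real).
    n \<ge> 1 \<longrightarrow> m \<ge> 1 \<longrightarrow>
    sym_psd n Q \<longrightarrow> c \<in> carrier_vec n \<longrightarrow> A \<in> carrier_mat m n \<longrightarrow> b \<in> carrier_vec m \<longrightarrow>
    0 < tol \<longrightarrow> tol < 1 \<longrightarrow>
    \<not> (A = 0\<^sub>m m n \<and> Q = 0\<^sub>m n n \<and> c = 0\<^sub>v n) \<longrightarrow>
    ipm.tau_E n Q c A tol < ipm.tau_A n Q c A b tol \<longrightarrow>
    (\<exists>x iterations dims.
       ipm.algorithm n m Q c A b tol = Some (x, iterations, dims) \<and>
       x \<in> Omega n \<and>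
       (\<forall>xs. is_arg_min (quad_obj Q c)
               (\<lambda>\<xi>. \<xi> \<in> Omega_closure n \<and> norm2 (A *\<^sub>v \<xi> - b) = min_residual n A b) xs \<longrightarrow>
             quad_obj Q c x \<le> quad_obj Q c xs + tol) \<and>
       norm2 (A *\<^sub>v x - b) \<le> min_residual n A b + tol \<and>
       real iterations \<le> C * ipm.L n m Q c A b tol * sqrt (real n) \<and>
       real (length dims) \<le> C * ipm.L n m Q c A b tol * sqrt (real n) \<and>
       (\<forall>d\<in>set dims. d \<le> 3 * n + m)))"
proof (intro exI[of _ 3000] conjI allI impI)
  fix n m :: nat and Q A :: "real mat" and c b :: "real vec" and tol :: real
  assume "1 \<le> n" "1 \<le> m" "sym_psd n Q" "c \<in> carrier_vec n" "A \<in> carrier_mat m n" "b \<in> carrier_vec m"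
    "0 < tol" "tol < 1" "\<not> (A = 0\<^sub>m m n \<and> Q = 0\<^sub>m n n \<and> c = 0\<^sub>v n)"
    "ipm.tau_E n Q c A tol < ipm.tau_A n Q c A b tol"
  then interpret ipm_instance n m Q c A b tol by unfold_locales auto
  obtain z it ds \<tau> where *: "algorithm = Some (X z, it, ds)" "path_point \<tau> z" "0 < \<tau>" "\<tau> \<le> tau_E"
    "it \<le> K + M" "length ds \<le> K + 1 + 3 * M" "\<forall>d\<in>set ds. d \<le> N"
    by (rule algorithm_Some)
  show "\<exists>x iterations dims.
       algorithm = Some (x, iterations, dims) \<and>
       x \<in> Omega n \<and>
       (\<forall>xs. is_arg_min (quad_obj Q c)
               (\<lambda>\<xi>. \<xi> \<in> Omega_closure n \<and> norm2 (A *\<^sub>v \<xi> - b) = min_residual n A b) xs \<longrightarrow>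
             quad_obj Q c x \<le> quad_obj Q c xs + tol) \<and>
       norm2 (A *\<^sub>v x - b) \<le> min_residual n A b + tol \<and>
       real iterations \<le> 3000 * L * sqrt (real n) \<and>
       real (length dims) \<le> 3000 * L * sqrt (real n) \<and>
       (\<forall>d\<in>set dims. d \<le> 3 * n + m)"
  proof (intro exI conjI allI impI)
    show "X z \<in> Omega n" using *(2) by (simp add: path_point_def interior_point_def)
    show "quad_obj Q c (X z) \<le> quad_obj Q c xs + tol"
      if "is_arg_min (quad_obj Q c)
          (\<lambda>\<xi>. \<xi> \<in> Omega_closure n \<and> norm2 (A *\<^sub>v \<xi> - b) = min_residual n A b) xs" for xs
      using that by (intro objective_accuracy[OF *(2-4)]) (auto simp: is_arg_min_def)
    show "norm2 (A *\<^sub>v X z - b) \<le> min_residual n A b + tol" by (rule residual_accuracy[OF *(2-4)])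
    have "real it \<le> real (K + M)" using *(5) by (rule of_nat_mono)
    then show "real it \<le> 3000 * L * sqrt (real n)" using iteration_bounds(1) by (rule order_trans)
    have "real (length ds) \<le> real (K + 1 + 3 * M)" using *(6) by (rule of_nat_mono)
    then show "real (length ds) \<le> 3000 * L * sqrt (real n)" using iteration_bounds(2) by (rule order_trans)
    show "\<forall>d\<in>set ds. d \<le> 3 * n + m" using *(7) by (simp add: N_def)
  qed (rule *(1))
qed simp

end
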